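(* Let $2\le k\le q$ and $m$ be integers, and let $\mathfrak P$ be a prime ideal of $A$ generated by $P$ with $\deg P=1$ and $P(0)=1$. Then: (1) each $\mathbf c_j$, $0\le j\le k-2$, is an eigenfunction of the Hecke operator $T_{\mathfrak P}$ with eigenvalue $\lambda_j(P)$; (2) the Hecke operators $T_{\mathfrak P}$ at the prime ideals of degree one are simultaneously diagonalized on $H_{k,m}(\Gamma_1(T))$ (equivalently on $S_{k,m}(\Gamma_1(T))$) with respect to the basis $\mathbf c_j$, $0\le j\le k-2$.
   Context: Let $\mathbb F$ be a finite field with $q$ elements, $A=\mathbb F[T]$, $K_\infty=\mathbb F((1/T))$, $\mathcal O_\infty$ its valuation ring, $C$ the completion of an algebraic closure of $K_\infty$, $\Omega=C\setminus K_\infty$ with $\mathrm{GL}_2(K_\infty)$ acting by fractional linear transformations, and $(f|_{k,m}\gamma)(z)=f(\gamma z)(\det\gamma)^m(cz+d)^{-k}$ for $\gamma=\begin{pmatrix}a&b\\c&d\end{pmatrix}$. For a congruence subgroup $\Gamma\subseteq \mathrm{GL}_2(A)$, $S_{k,m}(\Gamma)$ is the space of Drinfeld cusp forms of weight $k$, type $m$ (rigid analytic $f$ on $\Omega$ with $f|_{k,m}\gamma=f$ for $\gamma\in\Gamma$, holomorphic and vanishing at all cusps). Let $\Gamma_1(T)=\{\begin{pmatrix}a&b\\c&d\end{pmatrix}\in\mathrm{GL}_2(A): a\equiv d\equiv 1,\ c\equiv 0 \bmod T\}$. Tree and cocycles: $\mathcal T$ is the Bruhat–Tits tree with directed edges $\mathrm{PGL}_2(K_\infty)/\mathfrak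 I_\infty$ ($\mathfrak I_\infty$ the Iwahori subgroup, image of matrices in $\mathrm{GL}_2(\mathcal O_\infty)$ with lower left entry in $\frac1T\mathcal O_\infty$), $\langle g\rangle$ the edge represented by $g$. $V(k,m)$ has basis $X^jY^{k-2-j}$ ($0\le j\le k-2$), and $(\gamma w)(X^jY^{k-2-j})=(\det\gamma)^{1-m}w((aX+bY)^j(cX+dY)^{k-2-j})$ for $w\in\mathrm{Hom}(V(k,m),C)$. $H_{k,m}(\Gamma)$ is the space of harmonic cocycles: maps $\mathbf c$ from directed edges to $\mathrm{Hom}(V(k,m),C)$ whose values on edges with a common terminal vertex sum to $0$, with $\mathbf c(\bar e)=-\mathbf c(e)$ and $\mathbf c(\gamma e)=\gamma\mathbf c(e)$ for $\gamma\in\Gamma$. The residue map $\mathrm{Res}(f)(e)(X^jY^{k-2-j})=\mathrm{Res}_e z^jf(z)dz$ is an isomorphism $S_{k,m}(\Gamma)\cong H_{k,m}(\Gamma)$. Hecke operator: for a maximal ideal $\mathfrak P\ne(T)$ with generator $P$, $P(0)=1$, $d=\deg P$, $T_{\mathfrak P}f=P^{k-m-1}\big[f|_{k,m}\begin{pmatrix}P&0\\0&1\end{pmatrix}+\sum_{b\in A,\deg b<d}f|_{k,m}\begin{pmatrix}1&b(1-P)\\0&P\end{pmatrix}\big]$; on cocycles, $T_{\mathfrak P}\mathbf c(e)=P^{k-m-1}\big(g_0^{-1}\mathbf c(g_0e)+\sum_{b}g_b^{-1}\mathbf c(g_be)\big)$, $g_0=\begin{pmatrix}P&0\\0&1\end{pmatrix}$,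 $g_b=\begin{pmatrix}1&b(1-P)\\0&P\end{pmatrix}$. Let $\gamma_0=\langle\begin{pmatrix}0&1\\1&0\end{pmatrix}\rangle$. A cocycle in $H_{k,m}(\Gamma_1(T))$ is uniquely determined by $\mathbf c(\gamma_0)$, and every element of $\mathrm{Hom}(V(k,m),C)$ occurs; $\mathbf c_j$ ($0\le j\le k-2$) denotes the cocycle with $\mathbf c_j(\gamma_0)(X^lY^{k-2-l})=1$ if $l=j$ and $0$ otherwise. For $Q=1+\beta T$, $\lambda_j(Q)=\sum_{l=0}^{j}\binom{j}{l}\binom{k-2-j}{l}(1-Q)^l$ (binomial coefficients read in $\mathbb F$). *)

theory Defs
  imports "HOL-Computational_Algebra.Polynomial" "HOL-Computational_Algebra.Formal_Laurent_Series"
begin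

datatype 'a mat2 = Mat2 'a 'a 'a 'a  (* Mat2 a b c d = ((a,b),(c,d)) *)

fun mmul :: "'a::comm_ring_1 mat2 \<Rightarrow> 'a mat2 \<Rightarrow> 'a mat2" where
  "mmul (Mat2 a b c d) (Mat2 a' b' c' d') =
     Mat2 (a*a' + b*c') (a*b' + b*d') (c*a' + d*c') (c*b' + d*d')"

fun mdet :: "'a::comm_ring_1 mat2 \<Rightarrow> 'a" where
  "mdet (Mat2 a b c d) = a*d - b*c"

fun minv :: "'a::field mat2 \<Rightarrow> 'a mat2" where
  "minv (Mat2 a b c d) = (let \<delta> = a*d - b*c in Mat2 (d/\<delta>) (-b/\<delta>) (-c/\<delta>) (a/\<delta>))"

fun mmap :: "('a \<Rightarrow> 'b) \<Rightarrow> 'a mat2 \<Rightarrow> 'b mat2" where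
  "mmap f (Mat2 a b c d) = Mat2 (f a) (f b) (f c) (f d)"

fun msmult :: "'a::comm_ring_1 \<Rightarrow> 'a mat2 \<Rightarrow> 'a mat2" where
  "msmult l (Mat2 a b c d) = Mat2 (l*a) (l*b) (l*c) (l*d)"

text \<open>K_infinity is modelled as formal Laurent series 'f fls in the variable 1/T,
  so the uniformizer 1/T is fls_X and T is fls_X_inv.\<close>

definition Kinf_of_poly :: "'f::field poly \<Rightarrow> 'f fls" where
  "Kinf_of_poly p = poly (map_poly fls_const p) fls_X_inv"

definition Oinf :: "'f::field fls set" where
  "Oinf = {x. x = 0 \<or> fls_subdegree x \<ge> 0}"

definition Oinf_units :: "'f::field fls set" where
  "Oinf_units = {x. x \<noteq> 0 \<and> fls_subdegree x = 0}"

definition GL2K :: "'f::field fls mat2 set" where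
  "GL2K = {g. mdet g \<noteq> 0}"

definition GL2O :: "'f::field fls mat2 set" where
  "GL2O = {Mat2 a b c d | a b c d. a \<in> Oinf \<and> b \<in> Oinf \<and> c \<in> Oinf \<and> d \<in> Oinf
                                  \<and> a*d - b*c \<in> Oinf_units}"

definition Iwahori :: "'f::field fls mat2 set" where
  "Iwahori = {Mat2 a b c d | a b c d. Mat2 a b c d \<in> GL2O \<and> c \<in> {fls_X * x | x. x \<in> Oinf}}"

text \<open>Directed edges: PGL2(K)/Iwahori, i.e. classes of GL2(K) modulo scalars on the
  left-hand side and the Iwahori subgroup on the right.  Vertices: PGL2(K)/PGL2(O).\<close>

definition edge_of :: "'f::field fls mat2 \<Rightarrow> 'f fls mat2 set" where
  "edge_of g = {h \<in> GL2K. \<exists>l u. l \<noteq> 0 \<and> u \<in> Iwahori \<and> h = msmult l (mmul g u)}"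

definition vertex_of :: "'f::field fls mat2 \<Rightarrow> 'f fls mat2 set" where
  "vertex_of g = {h \<in> GL2K. \<exists>l u. l \<noteq> 0 \<and> u \<in> GL2O \<and> h = msmult l (mmul g u)}"

definition Edges :: "'f::field fls mat2 set set" where
  "Edges = edge_of ` GL2K"

definition Vertices :: "'f::field fls mat2 set set" where
  "Vertices = vertex_of ` GL2K"

text \<open>The Iwahori subgroup stabilizes the standard vertices [1] and [diag(1,1/T)];
  the edge <g> goes from the vertex [g] to the vertex [g diag(1,1/T)].\<close>
definition terminal_vertex_rep :: "'f::field fls mat2 \<Rightarrow> 'f fls mat2" where
  "terminal_vertex_rep g = mmul g (Mat2 1 0 0 fls_X)"

definition edges_into :: "'f::field fls mat2 set \<Rightarrow> 'f fls mat2 set set" where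
  "edges_into v = {edge_of g | g. g \<in> GL2K \<and> vertex_of (terminal_vertex_rep g) = v}"

definition reverse_rep :: "'f::field fls mat2 \<Rightarrow> 'f fls mat2" where
  "reverse_rep g = mmul g (Mat2 0 1 fls_X 0)"

text \<open>An element w of Hom(V(k,m),C) is represented by the function l \<mapsto> w(X^l Y^(k-2-l)),
  required to vanish for l > k-2.  The coefficient field C is an arbitrary field
  'c together with a ring homomorphism iota : K_infinity \<rightarrow> 'c.\<close>

definition homV :: "nat \<Rightarrow> (nat \<Rightarrow> 'c::field) set" where
  "homV k = {w. \<forall>l. l > k - 2 \<longrightarrow> w l = 0}"

text \<open>(gamma w)(X^j Y^(k-2-j)) = det(gamma)^(1-m) w((aX+bY)^j (cX+dY)^(k-2-j));
  the coefficient of X^l Y^(k-2-l) of (aX+bY)^j (cX+dY)^(k-2-j) is the coefficient of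
  x^l in (a x + b)^j (c x + d)^(k-2-j).\<close>
definition act :: "('f::field fls \<Rightarrow> 'c::field) \<Rightarrow> nat \<Rightarrow> int \<Rightarrow> 'f fls mat2
                     \<Rightarrow> (nat \<Rightarrow> 'c) \<Rightarrow> (nat \<Rightarrow> 'c)" where
  "act \<iota> k m \<gamma> w = (\<lambda>j. if j \<le> k - 2 then
      (case mmap \<iota> \<gamma> of Mat2 a b c d \<Rightarrow>
         (\<iota> (mdet \<gamma>)) powi (1 - m) *
         (\<Sum>l\<le>k-2. coeff ([:b, a:] ^ j * [:d, c:] ^ (k - 2 - j)) l * w l))
     else 0)"

definition Gamma1T :: "'f::field poly mat2 set" where
  "Gamma1T = {Mat2 a b c d | a b c d. a*d - b*c \<noteq> 0 \<and> degree (a*d - b*c) = 0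
               \<and> poly a 0 = 1 \<and> poly d 0 = 1 \<and> poly c 0 = 0}"

definition harmonic_cocycles ::
  "('f::field fls \<Rightarrow> 'c::field) \<Rightarrow> nat \<Rightarrow> int \<Rightarrow> 'f poly mat2 set
     \<Rightarrow> ('f fls mat2 set \<Rightarrow> nat \<Rightarrow> 'c) set" where
  "harmonic_cocycles \<iota> k m \<Gamma> =
     {c. (\<forall>E. E \<notin> Edges \<longrightarrow> c E = (\<lambda>_. 0))
       \<and> (\<forall>E. c E \<in> homV k)
       \<and> (\<forall>v \<in> Vertices. \<forall>l. (\<Sum>E \<in> edges_into v. c E l) = 0)
       \<and> (\<forall>g \<in> GL2K. (\<forall>l. c (edge_of (reverse_rep g)) l = - c (edge_of g) l))
       \<and> (\<forall>\<gamma> \<in> \<Gamma>. \<forall>g \<in> GL2K.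
            c (edge_of (mmul (mmap Kinf_of_poly \<gamma>) g)) = act \<iota> k m (mmap Kinf_of_poly \<gamma>) (c (edge_of g)))}"

definition hecke_rep ::
  "('f::{field,finite} fls \<Rightarrow> 'c::field) \<Rightarrow> nat \<Rightarrow> int \<Rightarrow> 'f poly
     \<Rightarrow> ('f fls mat2 set \<Rightarrow> nat \<Rightarrow> 'c) \<Rightarrow> 'f fls mat2 \<Rightarrow> nat \<Rightarrow> 'c" where
  "hecke_rep \<iota> k m P c h =
     (let Pk = Kinf_of_poly P;
          g0 = Mat2 Pk 0 0 1;
          gb = (\<lambda>b. Mat2 1 (Kinf_of_poly (b * (1 - P))) 0 Pk)
      in (\<lambda>l. (\<iota> Pk) powi (int k - m - 1) *
             (act \<iota> k m (minv g0) (c (edge_of (mmul g0 h))) l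
              + (\<Sum>b \<in> {b. degree b < degree P}. act \<iota> k m (minv (gb b)) (c (edge_of (mmul (gb b) h))) l))))"

definition hecke ::
  "('f::{field,finite} fls \<Rightarrow> 'c::field) \<Rightarrow> nat \<Rightarrow> int \<Rightarrow> 'f poly
     \<Rightarrow> ('f fls mat2 set \<Rightarrow> nat \<Rightarrow> 'c) \<Rightarrow> 'f fls mat2 set \<Rightarrow> nat \<Rightarrow> 'c" where
  "hecke \<iota> k m P c E = (if E \<in> Edges then hecke_rep \<iota> k m P c (SOME h. h \<in> E) else (\<lambda>_. 0))"

definition gamma0 :: "'f::field fls mat2 set" where
  "gamma0 = edge_of (Mat2 0 1 1 0)"

definition cj :: "('f::field fls \<Rightarrow> 'c::field) \<Rightarrow> nat \<Rightarrow> int \<Rightarrow> nat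
                   \<Rightarrow> 'f fls mat2 set \<Rightarrow> nat \<Rightarrow> 'c" where
  "cj \<iota> k m j = (THE c. c \<in> harmonic_cocycles \<iota> k m Gamma1T
                        \<and> c gamma0 = (\<lambda>l. if l = j then 1 else 0))"

definition lambdaj :: "nat \<Rightarrow> nat \<Rightarrow> 'f::field poly \<Rightarrow> 'f poly" where
  "lambdaj k j Q = (\<Sum>l\<le>j. of_nat ((j choose l) * ((k - 2 - j) choose l)) * (1 - Q) ^ l)"

end

theory Submission
  imports Defs
begin

text \<open>
  Up to orientation, an edge is given by a level \<open>n\<close> and a point \<open>y\<close> modulo \<open>T^(-n-1)\<close>, and
  harmonicity expresses the value of a cocycle at level \<open>n - 1\<close> as a sum of values at level \<open>n\<close>.
  The Euclidean algorithm, carried out with elements of \<open>\<Gamma>\<^sub>1(T)\<close>, lowers the level unless \<open>y = 0\<close>;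
  hence a cocycle vanishing at \<open>\<gamma>\<^sub>0\<close> vanishes.
  Conversely, the stabilizer of \<open>\<gamma>\<^sub>0\<close> is trivial and no element of \<open>\<Gamma>\<^sub>1(T)\<close> inverts it, so any
  value at \<open>\<gamma>\<^sub>0\<close> extends equivariantly to the orbit of \<open>\<gamma>\<^sub>0\<close> and its reversals. The extension by
  zero is harmonic: the sums at the two end vertices of \<open>\<gamma>\<^sub>0\<close> involve the power sums of
  degree at most \<open>k - 2 < q - 1\<close> over \<open>F\<close>, which vanish.
  Since a Hecke operator preserves harmonic cocycles, its eigenvalue is read off at \<open>\<gamma>\<^sub>0\<close>. There only
  the representatives with \<open>b \<noteq> 0\<close> contribute, and \<open>\<Sum>b\<noteq>0. b^(l-i)\<close>, which is \<open>-1\<close> for \<open>l = i\<close>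
  and \<open>0\<close> otherwise, extracts \<open>\<lambda>\<^sub>j\<close> from the binomial expansions.
\<close>

section \<open>Valuations\<close>

text \<open>The assumption \<open>k \<le> card UNIV\<close> enters because power sums over
  \<open>F\<close> of exponent below \<open>q - 1\<close> vanish, also for exponent 0. For the
  extension by zero, only vertices receiving a nonzero value need checking, that is, translates of
  the two ends of \<open>gamma0\<close>. The star of each end has one edge outside the orbit, given
  by \<open>mone\<close> or \<open>edge_rep 1 0\<close>; its other \<open>q\<close> edges are
  translates of \<open>gamma0\<close>, or of its reversal, by upper or lower unipotent elements. So
  the vertex condition says that summing \<open>w\<close> over these unipotents gives 0. The
  normalization \<open>P(0) = 1\<close> and the factor \<open>1 - P\<close> make all Hecke
  representatives congruent to the identity modulo \<open>T\<close>, so that \<open>Gamma1T\<close>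
  permutes their cosets. For \<open>b \<noteq> 0\<close> the representative is equivalent to the
  matrix with rows \<open>(1, b)\<close> and \<open>((1 - P)/b, 1)\<close>, of determinant
  \<open>P\<close>, which sends \<open>gamma0\<close> to a translate whose reversal is
  \<open>gamma0\<close>. Its inverse substitutes \<open>X - b Y\<close> and
  \<open>Y - (1 - P)/b X\<close> up to a power of \<open>P\<close> that cancels
  \<open>P^(k-m-1)\<close>; this is where the powers of \<open>1 - P\<close> in the eigenvalue come
  from. The sign of the reversal cancels the sign of \<open>q - 1 = -1\<close>.\<close>

definition vge :: "int \<Rightarrow> 'a::zero fls \<Rightarrow> bool" where
  "vge n x \<longleftrightarrow> (\<forall>i<n. fls_nth x i = 0)"

text \<open>Since \<open>fls_subdegree 0 = 0\<close>, a bound on \<open>fls_subdegree\<close>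
  misjudges the zero series; the condition on coefficients treats 0 as having infinite
  valuation.\<close>

lemma vge_iff: "vge n x \<longleftrightarrow> x = 0 \<or> n \<le> fls_subdegree x"
  unfolding vge_def
  by (metis fls_eq0_below_subdegree fls_nonzeroI fls_zero_nth linorder_not_less
      nth_fls_subdegree_nonzero order_less_le_trans)

lemma vge_0 [simp]: "vge n 0"
  by (simp add: vge_def)

lemma vge_add: "vge n x \<Longrightarrow> vge n y \<Longrightarrow> vge n (x + y)" for x :: "'a::monoid_add fls"
  by (simp add: vge_def)

lemma vge_uminus_iff [simp]: "vge n (- x) \<longleftrightarrow> vge n x" for x :: "'a::group_add fls"
  by (simp add: vge_def)

lemma vge_diff: "vge n x \<Longrightarrow> vge n y \<Longrightarrow> vge n (x - y)" for x :: "'a::group_add fls"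
  by (simp add: vge_def)

lemma vge_mono: "vge n x \<Longrightarrow> m \<le> n \<Longrightarrow> vge m x"
  by (simp add: vge_def)

lemma vge_mult: "vge m x \<Longrightarrow> vge n y \<Longrightarrow> vge (m + n) (x * y)" for x :: "'a::field fls"
  by (cases "x = 0 \<or> y = 0") (auto simp: vge_iff)

lemma vge_mult_0: "vge 0 x \<Longrightarrow> vge n y \<Longrightarrow> vge n (x * y)" for x :: "'a::field fls"
  using vge_mult[of 0 x n y] by simp

lemma vge_mult_0': "vge n x \<Longrightarrow> vge 0 y \<Longrightarrow> vge n (x * y)" for x :: "'a::field fls"
  using vge_mult[of n x 0 y] by simp

lemma vge_const [simp]: "n \<le> 0 \<Longrightarrow> vge n (fls_const b)"
  by (auto simp: vge_def)

lemma vge_1_iff [simp]: "vge n (1::'a::field fls) \<longleftrightarrow> n \<le> 0"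
  by (simp add: vge_iff)

lemma vge_X [simp]: "n \<le> 1 \<Longrightarrow> vge n (fls_X::'a::field fls)"
  by (auto simp: vge_def)

lemma subdegree_divide:
  "y \<noteq> 0 \<Longrightarrow> x \<noteq> 0 \<Longrightarrow> fls_subdegree (x / y) = fls_subdegree x - fls_subdegree y"
  for x y :: "'a::field fls"
  by (simp add: divide_inverse)

lemma vge_divide: "vge (n + fls_subdegree y) x \<Longrightarrow> vge n (x / y)" for x y :: "'a::field fls"
  by (cases "x = 0 \<or> y = 0") (auto simp: vge_iff subdegree_divide)

lemma fls_const_inverse: "fls_const (inverse b) = inverse (fls_const b)" for b :: "'a::field"
  by (simp add: fls_inverse_const)

lemma Oinf_iff: "x \<in> Oinf \<longleftrightarrow> vge 0 x"
  by (auto simp: Oinf_def vge_iff)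

lemma Pinf_iff: "c \<in> {fls_X * x |x. x \<in> Oinf} \<longleftrightarrow> vge 1 c" for c :: "'a::field fls"
proof
  assume "vge 1 c"
  then have "vge 0 (c / fls_X)"
    by (intro vge_divide) simp
  moreover have "c = fls_X * (c / fls_X)"
    by (simp del: fls_divide_X)
  ultimately show "c \<in> {fls_X * x |x. x \<in> Oinf}"
    unfolding Oinf_iff by blast
qed (use vge_mult[of 1 fls_X 0] in \<open>auto simp: Oinf_iff\<close>)

section \<open>Two by two matrices\<close>

abbreviation mone :: "'a::comm_ring_1 mat2" where
  "mone \<equiv> Mat2 1 0 0 1"

lemma mmul_assoc: "mmul (mmul g h) k = mmul g (mmul h k)"
  by (cases g; cases h; cases k) (simp add: algebra_simps)

lemma mmul_mone [simp]: "mmul mone g = g" "mmul g mone = g"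
  by (cases g; simp)+

lemma mdet_mmul [simp]: "mdet (mmul g h) = mdet g * mdet h"
  by (cases g; cases h) (simp add: algebra_simps)

lemma mdet_msmult [simp]: "mdet (msmult l g) = l\<^sup>2 * mdet g"
  by (cases g) (simp add: algebra_simps power2_eq_square)

lemma msmult_msmult [simp]: "msmult l (msmult l' g) = msmult (l * l') g"
  by (cases g) (simp add: algebra_simps)

lemma msmult_1 [simp]: "msmult 1 g = g"
  by (cases g) simp

lemma mmul_msmult [simp]: "mmul g (msmult l h) = msmult l (mmul g h)"
  "mmul (msmult l g) h = msmult l (mmul g h)"
  by (cases g; cases h; simp add: algebra_simps)+

lemma minv_right:
  fixes g :: "'a::field mat2"
  assumes "mdet g \<noteq> 0"
  shows "mmul g (minv g) = mone"
proof (cases g)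
  case (Mat2 a b c d)
  define \<delta> where "\<delta> = a * d - b * c"
  have "\<delta> \<noteq> 0"
    using assms by (simp add: Mat2 \<delta>_def)
  moreover have "a * d = \<delta> + b * c"
    by (simp add: \<delta>_def)
  ultimately show ?thesis
    unfolding Mat2 minv.simps \<delta>_def[symmetric] Let_def
    by (simp add: field_simps)
qed

lemma minv_left:
  fixes g :: "'a::field mat2"
  assumes "mdet g \<noteq> 0"
  shows "mmul (minv g) g = mone"
proof (cases g)
  case (Mat2 a b c d)
  define \<delta> where "\<delta> = a * d - b * c"
  have "\<delta> \<noteq> 0"
    using assms by (simp add: Mat2 \<delta>_def)
  moreover have "a * d = \<delta> + b * c"
    by (simp add: \<delta>_def)
  ultimately show ?thesis
    unfolding Mat2 minv.simps \<delta>_def[symmetric] Let_def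
    by (simp add: field_simps)
qed

lemma mdet_minv: "mdet g \<noteq> 0 \<Longrightarrow> mdet (minv g) = inverse (mdet g)"
  using arg_cong[OF minv_right[of g], of mdet] by (simp add: field_simps)

lemma minv_cancel [simp]:
  assumes "mdet g \<noteq> 0"
  shows "mmul g (mmul (minv g) h) = h" "mmul (minv g) (mmul g h) = h"
  using assms by (simp_all add: mmul_assoc[symmetric] minv_left minv_right)

lemma minv_unique: "mmul g h = mone \<Longrightarrow> minv g = h" for g :: "'a::field mat2"
proof -
  assume h: "mmul g h = mone"
  then have "mdet g * mdet h = 1"
    using mdet_mmul[of g h] by simp
  then have "mdet g \<noteq> 0"
    by auto
  with h minv_cancel(2)[of g h] show ?thesis
    by simp
qed

lemma minv_mmul:
  "mdet g \<noteq> 0 \<Longrightarrow> mdet h \<noteq> 0 \<Longrightarrow> minv (mmul g h) = mmul (minv h) (minv g)" for g :: "'a::field mat2"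
  by (rule minv_unique) (simp add: mmul_assoc minv_right)

lemma GL2K_mmul [intro]: "g \<in> GL2K \<Longrightarrow> h \<in> GL2K \<Longrightarrow> mmul g h \<in> GL2K"
  by (simp add: GL2K_def)

lemma GL2K_msmult [intro]: "l \<noteq> 0 \<Longrightarrow> g \<in> GL2K \<Longrightarrow> msmult l g \<in> GL2K"
  by (simp add: GL2K_def)

section \<open>Cosets modulo the center\<close>

text \<open>Edges and vertices differ only in the subgroup on the right, so the coset arguments are
  carried out once for a general \<open>U\<close>.\<close>

definition coset_of :: "'f::field fls mat2 set \<Rightarrow> 'f fls mat2 \<Rightarrow> 'f fls mat2 set" where
  "coset_of U g = {h \<in> GL2K. \<exists>l u. l \<noteq> 0 \<and> u \<in> U \<and> h = msmult l (mmul g u)}"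

definition msubgroup :: "'f::field fls mat2 set \<Rightarrow> bool" where
  "msubgroup U \<longleftrightarrow> U \<subseteq> GL2K \<and> mone \<in> U \<and> (\<forall>u\<in>U. \<forall>v\<in>U. mmul u v \<in> U) \<and> (\<forall>u\<in>U. minv u \<in> U)"

lemma edge_of_conv_coset: "edge_of = coset_of Iwahori"
  by (simp add: fun_eq_iff edge_of_def coset_of_def)

lemma vertex_of_conv_coset: "vertex_of = coset_of GL2O"
  by (simp add: fun_eq_iff vertex_of_def coset_of_def)

lemma coset_eq_iff:
  assumes U: "msubgroup U" and g: "g \<in> GL2K" and h: "h \<in> GL2K"
  shows "coset_of U g = coset_of U h \<longleftrightarrow> (\<exists>l u. l \<noteq> 0 \<and> u \<in> U \<and> h = msmult l (mmul g u))"
proof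
  assume eq: "coset_of U g = coset_of U h"
  have "h = msmult 1 (mmul h mone)"
    by simp
  then have "h \<in> coset_of U h"
    using U h unfolding coset_of_def msubgroup_def by (metis (mono_tags, lifting) mem_Collect_eq one_neq_zero)
  then show "\<exists>l u. l \<noteq> 0 \<and> u \<in> U \<and> h = msmult l (mmul g u)"
    unfolding eq[symmetric] by (simp add: coset_of_def)
next
  assume "\<exists>l u. l \<noteq> 0 \<and> u \<in> U \<and> h = msmult l (mmul g u)"
  then obtain l u where l: "l \<noteq> 0" and u: "u \<in> U" and hg: "h = msmult l (mmul g u)"
    by blast
  have du: "mdet u \<noteq> 0"
    using U u by (auto simp: msubgroup_def GL2K_def)
  then have gh: "g = msmult (inverse l) (mmul h (minv u))"
    using l by (simp add: hg mmul_assoc minv_right)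
  have sub: "coset_of U x \<subseteq> coset_of U y"
    if "x = msmult r (mmul y v)" "r \<noteq> 0" "v \<in> U" for x y r v
  proof
    fix z assume "z \<in> coset_of U x"
    then obtain s t where "z \<in> GL2K" "s \<noteq> 0" "t \<in> U" "z = msmult s (mmul x t)"
      by (auto simp: coset_of_def)
    with that U show "z \<in> coset_of U y"
      unfolding coset_of_def msubgroup_def
      by (auto intro!: exI[of _ "s * r"] exI[of _ "mmul v t"] simp: mmul_assoc)
  qed
  show "coset_of U g = coset_of U h"
    using sub[OF hg l u] sub[OF gh] l u U by (auto simp: msubgroup_def)
qed

lemma coset_mmul:
  assumes "g \<in> GL2K"
  shows "coset_of U (mmul g h) = mmul g ` coset_of U h"
proof (intro equalityI subsetI)
  fix x assume "x \<in> coset_of U (mmul g h)"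
  then obtain l u where x: "x \<in> GL2K" "l \<noteq> 0" "u \<in> U" "x = msmult l (mmul (mmul g h) u)"
    by (auto simp: coset_of_def)
  then have "x = mmul g (msmult l (mmul h u))"
    by (simp add: mmul_assoc)
  moreover have "msmult l (mmul h u) \<in> GL2K"
    using x by (auto simp: GL2K_def)
  then have "msmult l (mmul h u) \<in> coset_of U h"
    using x unfolding coset_of_def by blast
  ultimately show "x \<in> mmul g ` coset_of U h"
    by blast
next
  fix x assume "x \<in> mmul g ` coset_of U h"
  then obtain l u where x: "x = mmul g (msmult l (mmul h u))" "msmult l (mmul h u) \<in> GL2K"
    "l \<noteq> 0" "u \<in> U"
    by (auto simp: coset_of_def)
  then have "x = msmult l (mmul (mmul g h) u)"
    by (simp add: mmul_assoc)
  moreover have "x \<in> GL2K"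
    using x assms by blast
  ultimately show "x \<in> coset_of U (mmul g h)"
    using x unfolding coset_of_def by blast
qed

lemma coset_mmul_cong:
  assumes "g \<in> GL2K" "coset_of U h = coset_of U h'"
  shows "coset_of U (mmul g h) = coset_of U (mmul g h')"
  using assms by (simp add: coset_mmul)

lemma GL2O_iff:
  "Mat2 a b c d \<in> GL2O \<longleftrightarrow> vge 0 a \<and> vge 0 b \<and> vge 0 c \<and> vge 0 d
     \<and> a * d - b * c \<noteq> 0 \<and> fls_subdegree (a * d - b * c) = 0"
  by (auto simp: GL2O_def Oinf_iff Oinf_units_def)

lemma Iwahori_iff: "Mat2 a b c d \<in> Iwahori \<longleftrightarrow> Mat2 a b c d \<in> GL2O \<and> vge 1 c"
  unfolding Iwahori_def Pinf_iff by simp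

lemma Iwahori_subset_GL2O: "Iwahori \<subseteq> GL2O"
  by (auto simp: Iwahori_def)

lemma GL2O_det: "u \<in> GL2O \<Longrightarrow> mdet u \<noteq> 0 \<and> fls_subdegree (mdet u) = 0"
  by (cases u) (simp add: GL2O_iff)

lemma GL2O_subset_GL2K: "GL2O \<subseteq> GL2K"
  using GL2O_det by (auto simp: GL2K_def)

lemma GL2O_mmul: "u \<in> GL2O \<Longrightarrow> v \<in> GL2O \<Longrightarrow> mmul u v \<in> GL2O"
  using GL2O_det[of u] GL2O_det[of v] mdet_mmul[of u v]
  by (cases u; cases v) (auto simp: GL2O_iff intro!: vge_add vge_mult_0)

lemma GL2O_minv: "u \<in> GL2O \<Longrightarrow> minv u \<in> GL2O"
  using GL2O_det[of u] mdet_minv[of u]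
  by (cases u) (auto simp: GL2O_iff Let_def intro!: vge_divide)

lemma msubgroup_GL2O: "msubgroup GL2O"
  using GL2O_subset_GL2K by (auto simp: msubgroup_def GL2O_mmul GL2O_minv GL2O_iff)

lemma msubgroup_Iwahori: "msubgroup Iwahori"
proof -
  have "mmul u v \<in> Iwahori" if uv: "u \<in> Iwahori" "v \<in> Iwahori" for u v
  proof -
    obtain a b c d a' b' c' d' where eq: "u = Mat2 a b c d" "v = Mat2 a' b' c' d'"
      by (metis mat2.exhaust)
    have "vge 1 (c * a' + d * c')"
      using uv unfolding eq by (intro vge_add vge_mult_0 vge_mult_0') (auto simp: Iwahori_iff GL2O_iff)
    moreover have "mmul u v \<in> GL2O"
      using uv Iwahori_subset_GL2O by (auto intro: GL2O_mmul)
    ultimately show ?thesis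
      by (simp add: eq Iwahori_iff)
  qed
  moreover have "minv u \<in> Iwahori" if "u \<in> Iwahori" for u
    using that GL2O_minv[of u] GL2O_det[of u]
    by (cases u) (auto simp: Iwahori_iff Let_def intro!: vge_divide)
  moreover have "Iwahori \<subseteq> GL2K"
    using Iwahori_subset_GL2O GL2O_subset_GL2K by blast
  ultimately show ?thesis
    by (auto simp: msubgroup_def Iwahori_iff GL2O_iff)
qed

lemma edge_eq_iff:
  "g \<in> GL2K \<Longrightarrow> h \<in> GL2K \<Longrightarrow>
     edge_of g = edge_of h \<longleftrightarrow> (\<exists>l u. l \<noteq> 0 \<and> u \<in> Iwahori \<and> h = msmult l (mmul g u))"
  unfolding edge_of_conv_coset by (rule coset_eq_iff[OF msubgroup_Iwahori])

lemma edge_eqE: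
  assumes "edge_of g = edge_of h" "g \<in> GL2K" "h \<in> GL2K"
  obtains l u where "l \<noteq> 0" "u \<in> Iwahori" "h = msmult l (mmul g u)"
  using assms(1) unfolding edge_eq_iff[OF assms(2,3)] by blast

lemma vertex_eq_iff:
  "g \<in> GL2K \<Longrightarrow> h \<in> GL2K \<Longrightarrow>
     vertex_of g = vertex_of h \<longleftrightarrow> (\<exists>l u. l \<noteq> 0 \<and> u \<in> GL2O \<and> h = msmult l (mmul g u))"
  unfolding vertex_of_conv_coset by (rule coset_eq_iff[OF msubgroup_GL2O])

lemma edge_of_mmul_cong:
  "g \<in> GL2K \<Longrightarrow> edge_of h = edge_of h' \<Longrightarrow> edge_of (mmul g h) = edge_of (mmul g h')"
  unfolding edge_of_conv_coset by (rule coset_mmul_cong)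

lemma edge_of_self: "g \<in> GL2K \<Longrightarrow> g \<in> edge_of g"
  using msubgroup_Iwahori
  by (auto simp: edge_of_def msubgroup_def intro!: exI[of _ 1] exI[of _ mone])

lemma edge_of_mem:
  assumes "g \<in> GL2K" "h \<in> edge_of g"
  shows "h \<in> GL2K" "edge_of h = edge_of g"
proof -
  show h: "h \<in> GL2K"
    using assms(2) by (simp add: edge_of_def)
  show "edge_of h = edge_of g"
    using assms edge_eq_iff[OF assms(1) h] by (simp add: edge_of_def)
qed

lemma edge_of_eqI:
  "g \<in> GL2K \<Longrightarrow> l \<noteq> 0 \<Longrightarrow> u \<in> Iwahori \<Longrightarrow> h = msmult l (mmul g u) \<Longrightarrow> edge_of h = edge_of g"
  using msubgroup_Iwahori by (auto simp: edge_eq_iff msubgroup_def intro!: edge_of_mem(2))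
    (auto simp: edge_of_def intro!: GL2K_msmult)

text \<open>The determinant of \<open>msmult l u\<close> has valuation twice that of
  \<open>l\<close>. This lets integrality of the entries of \<open>u\<close> pass to those of
  \<open>msmult l u\<close> in every comparison of two edges.\<close>

lemma scalar_unit:
  assumes "l \<noteq> 0" "u \<in> GL2O" "mdet (msmult l u) \<noteq> 0" "fls_subdegree (mdet (msmult l u)) = 0"
  shows "fls_subdegree l = 0"
  using assms GL2O_det[of u] by (simp add: power2_eq_square)

section \<open>The star of a vertex\<close>

lemma edge_of_msmult: "l \<noteq> 0 \<Longrightarrow> g \<in> GL2K \<Longrightarrow> edge_of (msmult l g) = edge_of g"
  using msubgroup_Iwahori by (intro edge_of_eqI[of g l mone]) (auto simp: msubgroup_def)

lemma reverse_rep_GL2K [intro]: "g \<in> GL2K \<Longrightarrow> reverse_rep g \<in> GL2K"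
  by (simp add: reverse_rep_def GL2K_def)

lemma reverse_rep_mmul: "reverse_rep (mmul g h) = mmul g (reverse_rep h)"
  by (simp add: reverse_rep_def mmul_assoc)

lemma reverse_rep_reverse_rep: "reverse_rep (reverse_rep g) = msmult fls_X g"
  by (cases g) (simp add: reverse_rep_def)

lemma edge_of_reverse_reverse: "g \<in> GL2K \<Longrightarrow> edge_of (reverse_rep (reverse_rep g)) = edge_of g"
  by (simp add: reverse_rep_reverse_rep edge_of_msmult)

text \<open>The reversing matrix normalizes the Iwahori subgroup; \<open>u'\<close> below is the
  conjugate of \<open>u\<close>.\<close>

lemma edge_of_reverse_cong:
  assumes g: "g \<in> GL2K" and h: "h \<in> GL2K" and eq: "edge_of g = edge_of h"
  shows "edge_of (reverse_rep g) = edge_of (reverse_rep h)"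
proof -
  obtain l u where l: "l \<noteq> 0" "u \<in> Iwahori" "h = msmult l (mmul g u)"
    using eq edge_eq_iff[OF g h] by blast
  obtain a b c d where u: "u = Mat2 a b c d"
    by (cases u)
  define u' where "u' = Mat2 d (c / fls_X) (b * fls_X) a"
  have c: "c = fls_X * (c / fls_X)"
    by (simp del: fls_divide_X)
  have "reverse_rep u = mmul (Mat2 0 1 fls_X 0) u'"
    using c by (simp add: u u'_def reverse_rep_def algebra_simps del: fls_divide_X)
  then have "reverse_rep h = msmult l (mmul (reverse_rep g) u')"
    by (simp add: l(3) reverse_rep_def mmul_assoc)
  moreover have "vge 0 (c / fls_X)" "vge 1 (b * fls_X)"
    using l(2) vge_divide[of 0 fls_X c] vge_mult[of 0 b 1 fls_X]
    by (auto simp: u Iwahori_iff GL2O_iff)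
  then have "u' \<in> Iwahori"
    using l(2) vge_mono[of 1 "b * fls_X" 0]
    by (simp add: u u'_def Iwahori_iff GL2O_iff mult.commute del: fls_divide_X)
  ultimately show ?thesis
    using l(1) g edge_of_eqI by (metis reverse_rep_GL2K)
qed

lemma edge_of_reverse_eq_iff:
  assumes "g \<in> GL2K" "h \<in> GL2K"
  shows "edge_of (reverse_rep g) = edge_of (reverse_rep h) \<longleftrightarrow> edge_of g = edge_of h"
  using assms edge_of_reverse_cong edge_of_reverse_reverse by (metis reverse_rep_GL2K)

text \<open>The first column modulo \<open>1/T\<close> identifies \<open>GL2O / Iwahori\<close> with
  the projective line over \<open>F\<close>. The Iwahori subgroup itself is the point at infinity
  and \<open>nbr \<beta>\<close> represents the affine point \<open>\<beta>\<close>.\<close>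

definition nbr :: "'f::field \<Rightarrow> 'f fls mat2" where
  "nbr \<beta> = Mat2 (fls_const \<beta>) 1 1 0"

lemma nbr_GL2O: "nbr \<beta> \<in> GL2O"
  by (simp add: nbr_def GL2O_iff)

lemma nbr_GL2K [intro]: "nbr \<beta> \<in> GL2K"
  using nbr_GL2O GL2O_subset_GL2K by blast

lemma GL2O_cases:
  assumes "u \<in> GL2O"
  obtains "u \<in> Iwahori" | \<beta> v where "v \<in> Iwahori" "u = mmul (nbr \<beta>) v"
proof -
  obtain a b c d where u: "u = Mat2 a b c d"
    by (cases u)
  note ab = assms[unfolded u GL2O_iff]
  show ?thesis
  proof (cases "vge 1 c")
    case True
    with assms that(1) show ?thesis
      by (simp add: u Iwahori_iff)
  next
    case False
    with ab have c: "c \<noteq> 0" "fls_subdegree c = 0"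
      by (auto simp: vge_iff)
    \<comment> \<open>The residue of \<open>a / c\<close> is the only choice that puts the lower
      left entry \<open>a - \<beta> c\<close> of \<open>v\<close> into the maximal ideal.\<close>
    define \<beta> where "\<beta> = fls_nth (a / c) 0"
    define v where "v = Mat2 c d (a - fls_const \<beta> * c) (b - fls_const \<beta> * d)"
    have "vge 0 (a / c)"
      using ab c by (intro vge_divide) auto
    then have "vge 1 (a / c - fls_const \<beta>)"
      unfolding vge_def by (auto simp: \<beta>_def fls_const_nth zless_add1_eq dest: zle_add1_eq_le[THEN iffD1])
    then have "vge 1 ((a / c - fls_const \<beta>) * c)"
      using ab by (intro vge_mult_0') auto
    also have "(a / c - fls_const \<beta>) * c = a - fls_const \<beta> * c"
      using c by (simp add: algebra_simps)
    finally have v1: "vge 1 (a - fls_const \<beta> * c)" .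
    have "mdet v = - mdet u"
      by (simp add: v_def u algebra_simps)
    then have "mdet v \<noteq> 0" "fls_subdegree (mdet v) = 0"
      using GL2O_det[OF assms] by simp_all
    then have "v \<in> Iwahori"
      using v1 ab vge_mono[OF v1, of 0]
      by (auto simp: v_def Iwahori_iff GL2O_iff intro!: vge_diff vge_mult_0)
    moreover have "u = mmul (nbr \<beta>) v"
      by (simp add: u nbr_def v_def)
    ultimately show ?thesis
      by (rule that(2))
  qed
qed

text \<open>Reversal exchanges the ends of an edge, so the edges into a vertex are the reversals of
  those leaving it, and the latter correspond to the cosets of the Iwahori subgroup in
  \<open>GL2O\<close>.\<close>

lemma edges_into_eq:
  assumes h: "h \<in> GL2K"
  shows "edges_into (vertex_of h)
    = insert (edge_of (reverse_rep h)) (range (\<lambda>\<beta>. edge_of (reverse_rep (mmul h (nbr \<beta>)))))"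
    (is "_ = ?rhs")
proof (intro equalityI subsetI)
  fix E assume "E \<in> edges_into (vertex_of h)"
  then obtain g where g: "g \<in> GL2K" "E = edge_of g" "vertex_of (terminal_vertex_rep g) = vertex_of h"
    by (auto simp: edges_into_def)
  have "terminal_vertex_rep g \<in> GL2K"
    using g(1) by (simp add: terminal_vertex_rep_def GL2K_def)
  then obtain l u where l: "l \<noteq> 0" "u \<in> GL2O" "terminal_vertex_rep g = msmult l (mmul h u)"
    using g(3) h vertex_eq_iff by metis
  have "reverse_rep g = mmul (terminal_vertex_rep g) (Mat2 0 1 1 0)"
    by (simp add: reverse_rep_def terminal_vertex_rep_def mmul_assoc)
  also have "\<dots> = msmult l (mmul h (mmul u (Mat2 0 1 1 0)))"
    by (simp add: l(3) mmul_assoc)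
  finally have rg: "reverse_rep g = msmult l (mmul h (mmul u (Mat2 0 1 1 0)))" .
  have w: "mmul u (Mat2 0 1 1 0) \<in> GL2O"
    using l(2) by (intro GL2O_mmul) (simp_all add: GL2O_iff)
  have "edge_of (reverse_rep g) \<in> insert (edge_of h) (range (\<lambda>\<beta>. edge_of (mmul h (nbr \<beta>))))"
    using w
  proof (cases rule: GL2O_cases)
    case 1
    then show ?thesis
      using edge_of_eqI[OF h l(1) _ rg] by simp
  next
    case (2 \<beta> v)
    have "edge_of (reverse_rep g) = edge_of (mmul h (nbr \<beta>))"
      using h l(1) 2 by (intro edge_of_eqI[of _ l v]) (auto simp: rg mmul_assoc)
    then show ?thesis
      by simp
  qed
  then consider "edge_of (reverse_rep g) = edge_of h"
    | \<beta> where "edge_of (reverse_rep g) = edge_of (mmul h (nbr \<beta>))"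
    by auto
  then have "edge_of (reverse_rep (reverse_rep g)) \<in> ?rhs"
  proof cases
    case 1
    then show ?thesis
      using edge_of_reverse_cong[of "reverse_rep g" h] h g(1) by auto
  next
    case (2 \<beta>)
    then show ?thesis
      using edge_of_reverse_cong[of "reverse_rep g" "mmul h (nbr \<beta>)"] h g(1) by auto
  qed
  then show "E \<in> ?rhs"
    using g by (simp add: edge_of_reverse_reverse)
next
  fix E assume "E \<in> ?rhs"
  then obtain u where u: "u \<in> GL2O" "E = edge_of (reverse_rep (mmul h u))"
  proof (elim insertE rangeE)
    assume "E = edge_of (reverse_rep h)"
    then show thesis
      using that[of mone] by (simp add: GL2O_iff)
  qed (use that nbr_GL2O in blast)
  have gu: "mmul h u \<in> GL2K"
    using h u(1) GL2O_subset_GL2K by auto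
  have "terminal_vertex_rep (reverse_rep (mmul h u)) = mmul (mmul h u) (msmult fls_X (Mat2 0 1 1 0))"
    by (simp add: reverse_rep_def terminal_vertex_rep_def mmul_assoc del: mmul_msmult)
  then have "terminal_vertex_rep (reverse_rep (mmul h u)) = msmult fls_X (mmul h (mmul u (Mat2 0 1 1 0)))"
    by (simp only: mmul_msmult mmul_assoc)
  moreover have "mmul u (Mat2 0 1 1 0) \<in> GL2O"
    using u(1) by (intro GL2O_mmul) (simp_all add: GL2O_iff)
  moreover have "terminal_vertex_rep (reverse_rep (mmul h u)) \<in> GL2K"
    using gu by (auto simp: terminal_vertex_rep_def reverse_rep_def GL2K_def)
  ultimately have "vertex_of (terminal_vertex_rep (reverse_rep (mmul h u))) = vertex_of h"
    using vertex_eq_iff[OF h] by (metis fls_X_nonzero)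
  then show "E \<in> edges_into (vertex_of h)"
    using gu u(2) by (auto simp: edges_into_def)
qed

text \<open>The quotient of the two matrices is lower unipotent with entry
  \<open>\<beta>' - \<beta>\<close>, a constant that must lie in the maximal ideal.\<close>

lemma edge_nbr_inj:
  assumes h: "h \<in> GL2K" and eq: "edge_of (mmul h (nbr \<beta>)) = edge_of (mmul h (nbr \<beta>'))"
  shows "\<beta> = \<beta>'"
proof -
  obtain l u where lu: "l \<noteq> 0" "u \<in> Iwahori"
    "mmul h (nbr \<beta>') = msmult l (mmul (mmul h (nbr \<beta>)) u)"
    using eq h edge_eq_iff[of "mmul h (nbr \<beta>)" "mmul h (nbr \<beta>')"] by auto
  have dh: "mdet h \<noteq> 0"
    using h by (simp add: GL2K_def)
  have "nbr \<beta>' = msmult l (mmul (nbr \<beta>) u)"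
    using arg_cong[OF lu(3), of "mmul (minv h)"] dh by (simp add: mmul_assoc)
  moreover have "mdet (nbr \<beta>) \<noteq> 0"
    by (simp add: nbr_def)
  ultimately have lu': "msmult l u = mmul (minv (nbr \<beta>)) (nbr \<beta>')"
    by simp
  have eq': "msmult l u = Mat2 1 0 (fls_const (\<beta>' - \<beta>)) 1"
    unfolding lu' by (simp add: nbr_def fls_minus_const)
  have "fls_subdegree l = 0"
    using lu Iwahori_subset_GL2O by (intro scalar_unit[of l u]) (auto simp: eq')
  moreover obtain a b c d where u: "u = Mat2 a b c d"
    by (cases u)
  ultimately have "vge 1 (l * c)"
    using lu by (intro vge_mult_0) (auto simp: Iwahori_iff vge_iff)
  then have "vge 1 (fls_const (\<beta>' - \<beta>))"
    using eq' by (simp add: u)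
  then show ?thesis
    by (auto simp: vge_def dest: spec[of _ 0])
qed

lemma edge_nbr_neq:
  assumes h: "h \<in> GL2K"
  shows "edge_of h \<noteq> edge_of (mmul h (nbr \<beta>))"
proof
  assume eq: "edge_of h = edge_of (mmul h (nbr \<beta>))"
  obtain l u where lu: "l \<noteq> 0" "u \<in> Iwahori"
    "mmul h (nbr \<beta>) = msmult l (mmul h u)"
    using eq h edge_eq_iff[of h "mmul h (nbr \<beta>)"] by auto
  have dh: "mdet h \<noteq> 0"
    using h by (simp add: GL2K_def)
  have eq': "nbr \<beta> = msmult l u"
    using arg_cong[OF lu(3), of "mmul (minv h)"] dh by simp
  have "fls_subdegree l = 0"
    using lu Iwahori_subset_GL2O by (intro scalar_unit[of l u]) (auto simp: eq'[symmetric] nbr_def)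
  moreover obtain a b c d where u: "u = Mat2 a b c d"
    by (cases u)
  ultimately have "vge 1 (l * c)"
    using lu by (intro vge_mult_0) (auto simp: Iwahori_iff vge_iff)
  then show False
    using eq' by (simp add: u nbr_def)
qed

lemma sum_edges_into:
  fixes h :: "'f::{field,finite} fls mat2" and \<phi> :: "'f fls mat2 set \<Rightarrow> 'c::comm_monoid_add"
  assumes h: "h \<in> GL2K"
  shows "(\<Sum>E\<in>edges_into (vertex_of h). \<phi> E)
    = \<phi> (edge_of (reverse_rep h)) + (\<Sum>\<beta>\<in>UNIV. \<phi> (edge_of (reverse_rep (mmul h (nbr \<beta>)))))"
proof -
  let ?e = "\<lambda>\<beta>. edge_of (reverse_rep (mmul h (nbr \<beta>)))"
  have "inj ?e"
    using edge_nbr_inj[OF h] h by (auto intro!: injI simp: edge_of_reverse_eq_iff GL2K_mmul nbr_GL2K)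
  moreover have "edge_of (reverse_rep h) \<notin> range ?e"
    using edge_nbr_neq[OF h] h by (auto simp: edge_of_reverse_eq_iff GL2K_mmul nbr_GL2K)
  ultimately show ?thesis
    by (simp add: edges_into_eq[OF h] sum.reindex)
qed

section \<open>Polynomials as Laurent series\<close>

lemma Kinf_0 [simp]: "Kinf_of_poly 0 = 0"
  by (simp add: Kinf_of_poly_def)

lemma Kinf_pCons: "Kinf_of_poly (pCons a p) = fls_const a + fls_X_inv * Kinf_of_poly p"
  by (simp add: Kinf_of_poly_def map_poly_pCons)

lemma Kinf_1 [simp]: "Kinf_of_poly 1 = 1"
  by (simp add: one_pCons Kinf_pCons)

lemma Kinf_add: "Kinf_of_poly (p + q) = Kinf_of_poly p + Kinf_of_poly q"
  by (induction p q rule: poly_induct2) (simp_all add: Kinf_pCons fls_plus_const algebra_simps)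

lemma Kinf_smult: "Kinf_of_poly (smult a p) = fls_const a * Kinf_of_poly p"
  by (induction p) (simp_all add: Kinf_pCons algebra_simps)

lemma Kinf_mult: "Kinf_of_poly (p * q) = Kinf_of_poly p * Kinf_of_poly q"
  by (induction p) (simp_all add: Kinf_pCons Kinf_add Kinf_smult algebra_simps)

lemma Kinf_minus: "Kinf_of_poly (- p) = - Kinf_of_poly p"
  using Kinf_add[of p "- p"] by (simp add: eq_neg_iff_add_eq_0 add.commute)

lemma Kinf_diff: "Kinf_of_poly (p - q) = Kinf_of_poly p - Kinf_of_poly q"
  using Kinf_add[of p "- q"] by (simp add: Kinf_minus)

lemma Kinf_const: "Kinf_of_poly [:a:] = fls_const a"
  by (simp add: Kinf_pCons)

lemma Kinf_nth: "fls_nth (Kinf_of_poly p) n = (if n \<le> 0 then coeff p (nat (- n)) else 0)"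
proof (induction p arbitrary: n)
  case (pCons a p)
  have "nat (- n) = Suc (nat (- (n + 1)))" if "n < 0"
    using that by simp
  then show ?case
    by (auto simp: Kinf_pCons fls_X_inv_times_conv_shift pCons.IH coeff_pCons split: nat.splits)
qed simp

lemma Kinf_eq_0_iff [simp]: "Kinf_of_poly p = 0 \<longleftrightarrow> p = 0"
proof
  assume "Kinf_of_poly p = 0"
  then have "coeff p n = 0" for n
    using Kinf_nth[of p "- int n"] by simp
  then show "p = 0"
    by (simp add: poly_eq_iff)
qed simp

text \<open>A polynomial in \<open>T\<close> has only nonpositive powers of the uniformizer. This
  fact and the next turn integrality of the entries of an element of \<open>Gamma1T\<close> into
  equations.\<close>

lemma vge_1_Kinf: "vge 1 (Kinf_of_poly p) \<longleftrightarrow> p = 0"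
proof
  assume v: "vge 1 (Kinf_of_poly p)"
  have "coeff p n = 0" for n
    using v Kinf_nth[of p "- int n"] by (simp add: vge_def)
  then show "p = 0"
    by (simp add: poly_eq_iff)
qed simp

lemma vge_0_Kinf:
  assumes "vge 0 (Kinf_of_poly p)"
  shows "p = [:poly p 0:]"
proof -
  have "coeff p (Suc n) = 0" for n
    using assms Kinf_nth[of p "- int (Suc n)"] by (simp add: vge_def del: of_nat_Suc)
  then show ?thesis
    by (intro poly_eqI) (auto simp: poly_0_coeff_0 coeff_pCons split: nat.splits)
qed

lemma polynomial_part:
  fixes y :: "'f::field fls"
  obtains p where "vge 1 (y - Kinf_of_poly p)"
proof -
  define N where "N = nat (- fls_subdegree y)"
  define p where "p = (\<Sum>i\<le>N. monom (fls_nth y (- int i)) i)"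
  have "coeff p i = fls_nth y (- int i)" for i
  proof (cases "i \<le> N")
    case False
    then have "- int i < fls_subdegree y"
      by (auto simp: N_def)
    with False show ?thesis
      by (simp add: p_def coeff_sum)
  qed (simp add: p_def coeff_sum)
  then have "vge 1 (y - Kinf_of_poly p)"
    by (auto simp: vge_def Kinf_nth)
  then show thesis
    by (rule that)
qed

section \<open>The action on binary forms\<close>

lemma mmap_Kinf_mmul:
  "mmap Kinf_of_poly (mmul g h) = mmul (mmap Kinf_of_poly g) (mmap Kinf_of_poly h)"
  by (cases g; cases h) (simp add: Kinf_add Kinf_mult)

lemma mdet_mmap_Kinf: "mdet (mmap Kinf_of_poly g) = Kinf_of_poly (mdet g)"
  by (cases g) (simp add: Kinf_diff Kinf_mult)

text \<open>Substitution of \<open>aX + bY\<close>, \<open>cX + dY\<close> into the form of degree \<open>n\<close>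
  whose dehomogenization at \<open>Y = 1\<close> is \<open>p\<close>.\<close>

definition hsub :: "nat \<Rightarrow> 'c::field mat2 \<Rightarrow> 'c poly \<Rightarrow> 'c poly" where
  "hsub n g p = (case g of Mat2 a b c d \<Rightarrow>
     \<Sum>j\<le>n. smult (coeff p j) ([:b, a:] ^ j * [:d, c:] ^ (n - j)))"

lemma hsub_add: "hsub n g (p + q) = hsub n g p + hsub n g q"
  by (cases g) (simp add: hsub_def smult_add_left sum.distrib)

lemma hsub_smult: "hsub n g (smult e p) = smult e (hsub n g p)"
proof (cases g)
  case (Mat2 a b c d)
  have "smult e (sum r J) = (\<Sum>j\<in>J. smult e (r j))" for r :: "nat \<Rightarrow> 'a poly" and J
    using sum_distrib_left[of "[:e:]" r J] by simp
  then show ?thesis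
    by (simp add: Mat2 hsub_def)
qed

lemma smult_power_mult_Suc:
  "j \<le> n \<Longrightarrow> smult e (p * q ^ (Suc n - j)) = q * smult e (p * q ^ (n - j))"
  by (simp add: Suc_diff_le algebra_simps)

text \<open>Reading \<open>p\<close> as a form of degree one higher multiplies the form by
  \<open>Y\<close>, which is replaced by \<open>cX + dY\<close>.\<close>

lemma hsub_Suc_degree:
  assumes "degree p \<le> n"
  shows "hsub (Suc n) (Mat2 a b c d) p = [:d, c:] * hsub n (Mat2 a b c d) p"
proof -
  have "coeff p (Suc n) = 0"
    using assms by (intro coeff_eq_0) simp
  then have "hsub (Suc n) (Mat2 a b c d) p
      = (\<Sum>j\<le>n. smult (coeff p j) ([:b, a:] ^ j * [:d, c:] ^ (Suc n - j)))"
    by (simp add: hsub_def)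
  also have "\<dots> = (\<Sum>j\<le>n. [:d, c:] * smult (coeff p j) ([:b, a:] ^ j * [:d, c:] ^ (n - j)))"
    by (intro sum.cong refl smult_power_mult_Suc) simp
  finally show ?thesis
    by (simp only: hsub_def mat2.case sum_distrib_left)
qed

lemma hsub_Suc_pCons: "hsub (Suc n) (Mat2 a b c d) (pCons 0 p) = [:b, a:] * hsub n (Mat2 a b c d) p"
  by (simp only: hsub_def mat2.case sum.atMost_Suc_shift coeff_pCons_Suc coeff_pCons_0 diff_Suc_Suc
        power_Suc sum_distrib_left mult_smult_right smult_0_left add_0 mult.assoc)

text \<open>Substitution is multiplicative on forms. A linear factor \<open>fX + eY\<close> raises
  the degree, hence the index of \<open>hsub\<close>, by one; the bound on the degree of
  \<open>p\<close> ensures that no coefficient is cut off.\<close>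

lemma hsub_linear_mult:
  assumes "degree p \<le> n"
  shows "hsub (Suc n) (Mat2 a b c d) ([:e, f:] * p)
    = [:b * f + d * e, a * f + c * e:] * hsub n (Mat2 a b c d) p"
proof -
  have "[:e, f:] * p = smult e p + smult f (pCons 0 p)"
    by simp
  then have "hsub (Suc n) (Mat2 a b c d) ([:e, f:] * p)
      = smult e ([:d, c:] * hsub n (Mat2 a b c d) p) + smult f ([:b, a:] * hsub n (Mat2 a b c d) p)"
    by (simp only: hsub_add hsub_smult hsub_Suc_degree[OF assms] hsub_Suc_pCons)
  also have "\<dots> = (smult e [:d, c:] + smult f [:b, a:]) * hsub n (Mat2 a b c d) p"
    by (simp only: distrib_right mult_smult_left)
  finally show ?thesis
    by (simp add: algebra_simps)
qed

lemma degree_linear_powers: "degree ([:e, f:] ^ i * [:g, h:] ^ r) \<le> i + r" for e :: "'a::field"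
proof -
  have "degree ([:e, f:] ^ i) \<le> 1 * i" "degree ([:g, h:] ^ r) \<le> 1 * r"
    by (intro order.trans[OF degree_power_le] mult_right_mono; simp)+
  then show ?thesis
    using degree_mult_le[of "[:e, f:] ^ i" "[:g, h:] ^ r"] by simp
qed

lemma hsub_linear_powers:
  "hsub (i + r) (Mat2 a b c d) ([:e, f:] ^ i * [:g, h:] ^ r)
    = [:b * f + d * e, a * f + c * e:] ^ i * [:b * h + d * g, a * h + c * g:] ^ r"
proof (induction i)
  case 0
  show ?case
  proof (induction r)
    case (Suc r)
    have "hsub (Suc (0 + r)) (Mat2 a b c d) ([:g, h:] * ([:e, f:] ^ 0 * [:g, h:] ^ r))
      = [:b * h + d * g, a * h + c * g:] * hsub (0 + r) (Mat2 a b c d) ([:e, f:] ^ 0 * [:g, h:] ^ r)"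
      by (rule hsub_linear_mult[OF degree_linear_powers])
    then show ?case
      using Suc by (simp only: power_Suc power_0 mult_1_left add_0 add_Suc_right)
  qed (simp add: hsub_def)
next
  case (Suc i)
  have "hsub (Suc (i + r)) (Mat2 a b c d) ([:e, f:] * ([:e, f:] ^ i * [:g, h:] ^ r))
    = [:b * f + d * e, a * f + c * e:] * hsub (i + r) (Mat2 a b c d) ([:e, f:] ^ i * [:g, h:] ^ r)"
    by (rule hsub_linear_mult[OF degree_linear_powers])
  then show ?case
    by (simp only: Suc.IH power_Suc mult.assoc add_Suc)
qed

text \<open>This evaluates the functional \<open>w\<close> at the form of degree \<open>n\<close>
  with dehomogenization \<open>p\<close>.\<close>

definition pairing :: "nat \<Rightarrow> (nat \<Rightarrow> 'c::field) \<Rightarrow> 'c poly \<Rightarrow> 'c" where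
  "pairing n w p = (\<Sum>l\<le>n. coeff p l * w l)"

lemma pairing_sum_smult:
  "pairing n w (\<Sum>j\<in>J. smult (s j) (p j)) = (\<Sum>j\<in>J. s j * pairing n w (p j))"
  by (simp add: pairing_def coeff_sum sum_distrib_left sum_distrib_right mult.assoc)
    (rule sum.swap)

lemma coeff_X_power: "coeff ([:0, 1:] ^ j) l = (if l = j then 1 else 0 :: 'a::comm_ring_1)"
  by (metis coeff_monom monom_altdef smult_1_left)

lemma pairing_X_power: "j \<le> n \<Longrightarrow> pairing n w ([:0, 1:] ^ j) = w j"
  by (simp add: pairing_def coeff_X_power if_distrib[of "\<lambda>x. x * _"] cong: if_cong)

section \<open>The coefficient field and the action as a linear representation\<close>

locale laurent_embedding =
  fixes \<iota> :: "'f::{field,finite} fls \<Rightarrow> 'c::field"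
  assumes hom_one: "\<iota> 1 = 1"
    and hom_add: "\<And>x y. \<iota> (x + y) = \<iota> x + \<iota> y"
    and hom_mult: "\<And>x y. \<iota> (x * y) = \<iota> x * \<iota> y"
begin

lemma hom_zero: "\<iota> 0 = 0"
  by (metis add_0_right add_left_imp_eq hom_add)

lemma hom_minus: "\<iota> (- x) = - \<iota> x"
  using hom_add[of x "- x"] by (simp add: hom_zero eq_neg_iff_add_eq_0 add.commute)

lemma hom_eq_0_iff: "\<iota> x = 0 \<longleftrightarrow> x = 0"
proof
  assume "\<iota> x = 0"
  then have "\<iota> (x * inverse x) = 0"
    by (simp add: hom_mult)
  then show "x = 0"
    using hom_one by (metis right_inverse zero_neq_one)
qed (simp add: hom_zero)

lemma hom_inverse: "\<iota> (inverse x) = inverse (\<iota> x)"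
proof (cases "x = 0")
  case False
  then have "\<iota> x * \<iota> (inverse x) = 1"
    by (simp add: hom_one flip: hom_mult)
  then show ?thesis
    by (simp add: inverse_unique)
qed (simp add: hom_zero)

lemma hom_power: "\<iota> (x ^ n) = \<iota> x ^ n"
  by (induction n) (simp_all add: hom_one hom_mult)

lemma hom_sum: "\<iota> (sum g A) = (\<Sum>a\<in>A. \<iota> (g a))"
  by (induction A rule: infinite_finite_induct) (simp_all add: hom_zero hom_add)

lemma hom_of_nat: "\<iota> (of_nat n) = of_nat n"
  by (induction n) (simp_all add: hom_zero hom_one hom_add)

lemma act_eq_pairing:
  "act \<iota> k m (Mat2 a b c d) w j = (if j \<le> k - 2 then \<iota> (a * d - b * c) powi (1 - m) *
     pairing (k - 2) w ([:\<iota> b, \<iota> a:] ^ j * [:\<iota> d, \<iota> c:] ^ (k - 2 - j)) else 0)"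
  by (simp add: act_def pairing_def)

text \<open>Up to the determinant factor, \<open>act\<close> is the dual of substitution. Evaluation
  at arbitrary forms, not only monomials, is what \<open>act_mmul\<close> needs.\<close>

lemma pairing_act:
  "pairing (k - 2) (act \<iota> k m g w) p
    = \<iota> (mdet g) powi (1 - m) * pairing (k - 2) w (hsub (k - 2) (mmap \<iota> g) p)"
proof (cases g)
  case (Mat2 a b c d)
  show ?thesis
    unfolding Mat2 hsub_def mmap.simps mat2.case pairing_sum_smult sum_distrib_left
    by (subst pairing_def) (auto simp: act_eq_pairing intro!: sum.cong)
qed

lemma act_mmul: "act \<iota> k m (mmul g h) w = act \<iota> k m g (act \<iota> k m h w)"
proof (rule ext)
  fix j
  obtain a b c d a' b' c' d' where gh: "g = Mat2 a b c d" "h = Mat2 a' b' c' d'"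
    by (metis mat2.exhaust)
  show "act \<iota> k m (mmul g h) w j = act \<iota> k m g (act \<iota> k m h w) j"
  proof (cases "j \<le> k - 2")
    case True
    then obtain r where r: "k - 2 = j + r"
      using le_Suc_ex by blast
    \<comment> \<open>Substituting \<open>h\<close> into the linear forms of \<open>g\<close> yields
      the linear forms of the product, so this is a left action.\<close>
    have "hsub (k - 2) (mmap \<iota> h) ([:\<iota> b, \<iota> a:] ^ j * [:\<iota> d, \<iota> c:] ^ (k - 2 - j))
      = [:\<iota> b' * \<iota> a + \<iota> d' * \<iota> b, \<iota> a' * \<iota> a + \<iota> c' * \<iota> b:] ^ j
        * [:\<iota> b' * \<iota> c + \<iota> d' * \<iota> d, \<iota> a' * \<iota> c + \<iota> c' * \<iota> d:] ^ (k - 2 - j)"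
      unfolding r diff_add_inverse gh mmap.simps by (rule hsub_linear_powers)
    moreover have "\<iota> (mdet (mmul g h)) = \<iota> (mdet g) * \<iota> (mdet h)"
      by (simp add: hom_mult)
    ultimately show ?thesis
      using True unfolding gh(1) act_eq_pairing pairing_act
      by (simp add: gh(2) act_eq_pairing hom_add hom_mult power_int_mult_distrib mult_ac)
  qed (simp add: gh act_eq_pairing)
qed

lemma act_homV: "act \<iota> k m g w \<in> homV k"
  by (cases g) (simp add: homV_def act_eq_pairing)

lemma act_mone: "w \<in> homV k \<Longrightarrow> act \<iota> k m mone w = w"
proof -
  have "[:1::'c:] ^ n = 1" for n
    by (simp flip: one_pCons)
  moreover assume "w \<in> homV k"
  ultimately show ?thesis
    by (auto simp: fun_eq_iff act_eq_pairing hom_one hom_zero pairing_X_power homV_def)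
qed

text \<open>The weights \<open>s\<close> make scaling, change of sign and the zero functional
  special cases.\<close>

lemma act_sum: "act \<iota> k m g (\<lambda>l. \<Sum>i\<in>I. s i * w i l) = (\<lambda>l. \<Sum>i\<in>I. s i * act \<iota> k m g (w i) l)"
proof -
  have "pairing n (\<lambda>l. \<Sum>i\<in>I. s i * w i l) p = (\<Sum>i\<in>I. s i * pairing n (w i) p)" for n p
    unfolding pairing_def sum_distrib_left by (subst sum.swap) (simp add: mult_ac)
  then show ?thesis
    by (cases g) (auto simp: fun_eq_iff act_eq_pairing sum_distrib_left mult_ac)
qed

lemma act_scale: "act \<iota> k m g (\<lambda>l. s * w l) = (\<lambda>l. s * act \<iota> k m g w l)"
  using act_sum[of k m g "\<lambda>_. s" "\<lambda>_. w" "{()}"] by simp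

lemma act_minus: "act \<iota> k m g (\<lambda>l. - w l) = (\<lambda>l. - act \<iota> k m g w l)"
  using act_scale[of k m g "-1" w] by simp

lemma act_zero: "act \<iota> k m g (\<lambda>l. 0) = (\<lambda>l. 0)"
  using act_scale[of k m g 0 "\<lambda>_. 0"] by simp

end

section \<open>Uniqueness of harmonic cocycles\<close>

text \<open>The determinant is a constant, and at \<open>T = 0\<close> the congruence conditions
  make it 1.\<close>

lemma Gamma1T_iff:
  "Mat2 a b c d \<in> Gamma1T \<longleftrightarrow> a * d - b * c = 1 \<and> poly a 0 = 1 \<and> poly d 0 = 1 \<and> poly c 0 = 0"
proof -
  have "a * d - b * c = 1"
    if "degree (a * d - b * c) = 0" "poly a 0 = 1" "poly d 0 = 1" "poly c 0 = 0"
  proof -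
    from degree_eq_zeroE[OF that(1)] obtain e where e: "a * d - b * c = [:e:]"
      by blast
    from arg_cong[OF this, of "\<lambda>p. poly p 0"] that have "e = 1"
      by simp
    with e show ?thesis
      by (simp add: one_pCons)
  qed
  then show ?thesis
    by (auto simp: Gamma1T_def)
qed

lemma Gamma1T_mmul: "g \<in> Gamma1T \<Longrightarrow> h \<in> Gamma1T \<Longrightarrow> mmul g h \<in> Gamma1T"
  using mdet_mmul[of g h] by (cases g; cases h) (simp add: Gamma1T_iff)

lemma Gamma1T_inverse:
  assumes "g \<in> Gamma1T"
  obtains g' where "g' \<in> Gamma1T" "mmul g g' = mone" "mmul g' g = mone"
proof (cases g)
  case (Mat2 a b c d)
  with assms show ?thesis
    by (intro that[of "Mat2 d (- b) (- c) a"]) (auto simp: Gamma1T_iff algebra_simps)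
qed

abbreviation mK :: "'f::field poly mat2 \<Rightarrow> 'f fls mat2" where
  "mK \<equiv> mmap Kinf_of_poly"

lemma mK_det: "g \<in> Gamma1T \<Longrightarrow> mdet (mK g) = 1"
  by (cases g) (simp add: mdet_mmap_Kinf Gamma1T_iff del: mmap.simps)

lemma mK_GL2K [intro]: "g \<in> Gamma1T \<Longrightarrow> mK g \<in> GL2K"
  by (simp add: GL2K_def mK_det)

lemma mone_Gamma1T [simp]: "mone \<in> Gamma1T"
  by (simp add: Gamma1T_iff)

lemma upper_Gamma1T [simp]: "Mat2 1 p 0 1 \<in> Gamma1T"
  by (simp add: Gamma1T_iff)

lemma lower_Gamma1T [simp]: "Mat2 1 0 (pCons 0 p) 1 \<in> Gamma1T"
  by (simp add: Gamma1T_iff)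

text \<open>The powers of the uniformizer, kept opaque because the simplifier turns products with
  \<^const>\<open>fls_X\<close> into shifts.\<close>

definition ppow :: "int \<Rightarrow> 'f::field fls" where
  "ppow n = fls_X powi n"

lemma ppow_nonzero [simp]: "ppow n \<noteq> 0"
  by (simp add: ppow_def)

lemma ppow_0 [simp]: "ppow 0 = 1"
  by (simp add: ppow_def)

lemma ppow_add: "ppow (i + j) = ppow i * ppow j"
  unfolding ppow_def by (rule power_int_add) simp

lemma fls_X_conv_ppow: "fls_X = ppow 1"
  unfolding ppow_def by (rule power_int_1_right[symmetric])

lemma subdegree_ppow [simp]: "fls_subdegree (ppow n) = n"
  by (simp add: ppow_def)

lemma vge_ppow [simp]: "vge m (ppow n :: 'f::field fls) \<longleftrightarrow> m \<le> n"
  by (simp add: vge_iff)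

lemma ppow_nth: "fls_nth (ppow n) i = (if i = n then 1 else 0)"
  by (simp add: ppow_def)

text \<open>Up to orientation, every edge leads from the end \<open>\<infinity>\<close> towards some \<open>y\<close>; the matrix
  below represents it.\<close>

definition edge_rep :: "int \<Rightarrow> 'f::field fls \<Rightarrow> 'f fls mat2" where
  "edge_rep n y = Mat2 y (ppow n) 1 0"

lemma edge_rep_GL2K [intro, simp]: "edge_rep n y \<in> GL2K"
  by (simp add: edge_rep_def GL2K_def)

text \<open>When \<open>c\<close> dominates the bottom row, an upper triangular Iwahori element
  clears \<open>d\<close>. The level is forced by the determinant: taking out the scalar
  \<open>c\<close> costs twice its valuation, and what remains, \<open>e\<close>, has to be a
  unit.\<close>

lemma edge_of_low:
  assumes "c \<noteq> 0" "vge (fls_subdegree c) d" "a * d - b * c \<noteq> 0"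
  shows "edge_of (Mat2 a b c d)
    = edge_of (edge_rep (fls_subdegree (a * d - b * c) - 2 * fls_subdegree c) (a / c))"
proof -
  define n where "n = fls_subdegree (a * d - b * c) - 2 * fls_subdegree c"
  define e where "e = - (a * d - b * c) / (c\<^sup>2 * ppow n)"
  define u where "u = Mat2 1 (d / c) 0 e"
  have "fls_subdegree (c\<^sup>2 * ppow n) = fls_subdegree (- (a * d - b * c))"
    using assms by (simp add: n_def power2_eq_square del: minus_diff_eq)
  then have "fls_subdegree e = 0"
    unfolding e_def using assms by (subst subdegree_divide) (auto simp del: minus_diff_eq)
  moreover have "e \<noteq> 0"
    using assms by (simp add: e_def)
  moreover have "vge 0 (d / c)"
    using assms by (intro vge_divide) simp
  ultimately have "u \<in> Iwahori"
    by (simp add: u_def Iwahori_iff GL2O_iff vge_iff)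
  moreover have "Mat2 a b c d = msmult c (mmul (edge_rep n (a / c)) u)"
    using assms(1) by (simp add: edge_rep_def u_def e_def field_simps power2_eq_square)
  ultimately show ?thesis
    unfolding n_def[symmetric] using assms(1) by (intro edge_of_eqI) auto
qed

text \<open>Right multiplication by a lower unipotent matrix with entry \<open>t\<close> moves
  \<open>y\<close> by \<open>t * ppow n\<close>, and \<open>t\<close> may be any element of the
  maximal ideal.\<close>

lemma edge_of_edge_rep_cong:
  assumes "vge (n + 1) (y - y')"
  shows "edge_of (edge_rep n y) = edge_of (edge_rep n y')"
proof -
  have "vge 1 ((y - y') / ppow n)"
    using assms by (intro vge_divide) (simp add: add.commute)
  then have "Mat2 1 0 ((y - y') / ppow n) 1 \<in> Iwahori"
    using vge_mono[of 1 _ 0] by (simp add: Iwahori_iff GL2O_iff)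
  moreover have "ppow n * ((y - y') / ppow n) = y - y'"
    by simp
  ultimately show ?thesis
    by (intro edge_of_eqI[OF edge_rep_GL2K one_neq_zero, of "Mat2 1 0 ((y - y') / ppow n) 1"])
      (simp_all add: edge_rep_def)
qed

lemma mmul_nbr_edge: "mmul (Mat2 (ppow n) y 0 1) (nbr \<beta>) = edge_rep n (y + fls_const \<beta> * ppow n)"
  by (simp add: nbr_def edge_rep_def mult.commute)

lemma reverse_edge_rep: "reverse_rep (edge_rep (n - 1) y) = Mat2 (ppow n) y 0 1"
proof -
  have "ppow (n - 1) * ppow 1 = (ppow n :: 'a fls)"
    by (simp flip: ppow_add)
  then show ?thesis
    by (simp add: reverse_rep_def edge_rep_def fls_X_conv_ppow)
qed

text \<open>When \<open>d\<close> dominates strictly, the edge points towards infinity. Reversal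
  swaps the columns and brings it under \<open>edge_of_low\<close>; the extra factor
  \<open>1/T\<close> adds 1 to the valuation of the determinant and 2 to the correction, whence the
  final \<open>- 1\<close>.\<close>

lemma edge_of_high:
  assumes "d \<noteq> 0" "vge (fls_subdegree d + 1) c" "a * d - b * c \<noteq> 0"
  shows "edge_of (reverse_rep (Mat2 a b c d))
    = edge_of (edge_rep (fls_subdegree (a * d - b * c) - 2 * fls_subdegree d - 1) (b / d))"
proof -
  let ?n = "fls_subdegree (a * d - b * c) - 2 * fls_subdegree d - 1"
  have r: "reverse_rep (Mat2 a b c d) = Mat2 (b * fls_X) a (d * fls_X) c"
    by (simp add: reverse_rep_def)
  have det: "(b * fls_X) * c - a * (d * fls_X) = - (fls_X * (a * d - b * c))"
    by (simp only: right_diff_distrib minus_diff_eq mult_ac)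
  have "edge_of (Mat2 (b * fls_X) a (d * fls_X) c)
    = edge_of (edge_rep (fls_subdegree ((b * fls_X) * c - a * (d * fls_X)) - 2 * fls_subdegree (d * fls_X))
         (b * fls_X / (d * fls_X)))"
    using assms by (intro edge_of_low) (simp_all add: det del: fls_divide_X)
  moreover have "fls_subdegree (d * fls_X) = fls_subdegree d + 1"
    using assms(1) by simp
  moreover have "fls_subdegree ((b * fls_X) * c - a * (d * fls_X)) = fls_subdegree (a * d - b * c) + 1"
    unfolding det using assms(3) by simp
  moreover have "b * fls_X / (d * fls_X) = b / d"
    by (rule nonzero_mult_divide_mult_cancel_right) simp
  ultimately show ?thesis
    by (simp add: r algebra_simps)
qed

lemma gamma0_conv_edge_rep: "gamma0 = edge_of (edge_rep 0 0)"
  by (simp add: gamma0_def edge_rep_def)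

section \<open>Vanishing of a cocycle that is zero at \<open>gamma0\<close>\<close>

context laurent_embedding
begin

abbreviation H :: "nat \<Rightarrow> int \<Rightarrow> ('f fls mat2 set \<Rightarrow> nat \<Rightarrow> 'c) set" where
  "H k m \<equiv> harmonic_cocycles \<iota> k m Gamma1T"

lemma cocycle_outside: "c \<in> H k m \<Longrightarrow> E \<notin> Edges \<Longrightarrow> c E = (\<lambda>_. 0)"
  by (simp add: harmonic_cocycles_def)

lemma cocycle_homV: "c \<in> H k m \<Longrightarrow> c E \<in> homV k"
  by (simp add: harmonic_cocycles_def)

lemma cocycle_reverse:
  "c \<in> H k m \<Longrightarrow> g \<in> GL2K \<Longrightarrow> c (edge_of (reverse_rep g)) = (\<lambda>l. - c (edge_of g) l)"
  by (simp add: harmonic_cocycles_def fun_eq_iff)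

lemma cocycle_equivariant:
  "c \<in> H k m \<Longrightarrow> \<gamma> \<in> Gamma1T \<Longrightarrow> g \<in> GL2K \<Longrightarrow>
     c (edge_of (mmul (mK \<gamma>) g)) = act \<iota> k m (mK \<gamma>) (c (edge_of g))"
  unfolding harmonic_cocycles_def by blast

text \<open>Reversal changes all signs at once, so harmonicity also holds for the edges leaving a
  vertex, which are easier to list.\<close>

lemma cocycle_star:
  assumes c: "c \<in> H k m" and h: "h \<in> GL2K"
  shows "c (edge_of h) l + (\<Sum>\<beta>\<in>UNIV. c (edge_of (mmul h (nbr \<beta>))) l) = 0"
proof -
  have "vertex_of h \<in> Vertices"
    using h by (simp add: Vertices_def)
  then have "(\<Sum>E\<in>edges_into (vertex_of h). c E l) = 0"
    using c by (simp add: harmonic_cocycles_def)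
  then have "- (c (edge_of h) l + (\<Sum>\<beta>\<in>UNIV. c (edge_of (mmul h (nbr \<beta>))) l)) = 0"
    using c h by (simp add: sum_edges_into cocycle_reverse GL2K_mmul nbr_GL2K sum_negf)
  then show ?thesis
    by (rule neg_equal_0_iff_equal[THEN iffD1])
qed

lemma cocycle_equivariant_zero:
  assumes c: "c \<in> H k m" and \<gamma>: "\<gamma> \<in> Gamma1T" and g: "g \<in> GL2K"
    and z: "c (edge_of (mmul (mK \<gamma>) g)) = (\<lambda>_. 0)"
  shows "c (edge_of g) = (\<lambda>_. 0)"
proof -
  obtain \<gamma>' where \<gamma>': "\<gamma>' \<in> Gamma1T" "mmul \<gamma>' \<gamma> = mone"
    using \<gamma> Gamma1T_inverse by metis
  have "g = mmul (mK \<gamma>') (mmul (mK \<gamma>) g)"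
    by (simp add: \<gamma>'(2) flip: mmul_assoc mmap_Kinf_mmul)
  then have "c (edge_of g) = act \<iota> k m (mK \<gamma>') (c (edge_of (mmul (mK \<gamma>) g)))"
    using cocycle_equivariant[OF c \<gamma>'(1), of "mmul (mK \<gamma>) g"] \<gamma> g by auto
  then show ?thesis
    by (simp add: z act_zero)
qed

text \<open>This is harmonicity at the common end of the edge of level \<open>n - 1\<close> and its
  \<open>q\<close> continuations, one for each next coefficient of \<open>y\<close>.\<close>

lemma cocycle_edge_rep_step:
  assumes c: "c \<in> H k m"
  shows "c (edge_of (edge_rep (n - 1) y)) l
    = (\<Sum>\<beta>\<in>UNIV. c (edge_of (edge_rep n (y + fls_const \<beta> * ppow n))) l)"
proof -
  have h: "Mat2 (ppow n) y 0 1 \<in> GL2K"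
    by (simp add: GL2K_def)
  have "c (edge_of (Mat2 (ppow n) y 0 1)) l = - c (edge_of (edge_rep (n - 1) y)) l"
    using cocycle_reverse[OF c, of "edge_rep (n - 1) y"] by (simp add: reverse_edge_rep)
  with cocycle_star[OF c h, of l] show ?thesis
    by (simp add: mmul_nbr_edge)
qed

lemma cocycle_translate_zero:
  assumes c: "c \<in> H k m" and z: "c (edge_of (edge_rep n (y - Kinf_of_poly p))) = (\<lambda>_. 0)"
  shows "c (edge_of (edge_rep n y)) = (\<lambda>_. 0)"
proof -
  have "mmul (mK (Mat2 1 (- p) 0 1)) (edge_rep n y) = edge_rep n (y - Kinf_of_poly p)"
    by (simp add: edge_rep_def Kinf_minus)
  with z show ?thesis
    using cocycle_equivariant_zero[OF c upper_Gamma1T] by (metis edge_rep_GL2K)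
qed

text \<open>At level 0 only \<open>y\<close> modulo the maximal ideal matters, and a polynomial
  translation removes the rest. Each lower level is a sum over the level above it.\<close>

lemma cocycle_zero_nonpos:
  assumes c: "c \<in> H k m" and z: "c gamma0 = (\<lambda>_. 0)"
  shows "c (edge_of (edge_rep (- int n) y)) = (\<lambda>_. 0)"
proof (induction n arbitrary: y)
  case 0
  obtain p where "vge 1 (y - Kinf_of_poly p)"
    by (rule polynomial_part)
  then have "edge_of (edge_rep 0 (y - Kinf_of_poly p)) = gamma0"
    unfolding gamma0_conv_edge_rep by (intro edge_of_edge_rep_cong) simp
  then show ?case
    using cocycle_translate_zero[OF c, of 0 y p] z by simp
next
  case (Suc n)
  have "- int (Suc n) = - int n - 1"
    by simp
  then show ?case
    using cocycle_edge_rep_step[OF c, of "- int n" y] Suc by (simp only: fun_eq_iff) simp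
qed

text \<open>One division step: a lower unipotent element subtracts from \<open>1/y\<close> its
  polynomial part. The assumption that \<open>y\<close> is not 0 modulo \<open>T^(-n-1)\<close>
  gives \<open>s \<le> n\<close>, which makes the level drop.\<close>

lemma cocycle_zero_step:
  assumes c: "c \<in> H k m" and n: "0 < n"
    and IH: "\<And>n' y'. n' < n \<Longrightarrow> c (edge_of (edge_rep n' y')) = (\<lambda>_. 0)"
    and y: "vge 1 y" "\<not> vge (n + 1) y"
  shows "c (edge_of (edge_rep n y)) = (\<lambda>_. 0)"
proof -
  have y0: "y \<noteq> 0"
    using y by auto
  define s where "s = fls_subdegree y"
  have s: "1 \<le> s" "s \<le> n"
    using y y0 by (auto simp: s_def vge_iff)
  obtain p where p: "vge 1 (inverse y - Kinf_of_poly p)"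
    by (rule polynomial_part)
  obtain e p' where p': "p = pCons e p'"
    by (cases p)
  \<comment> \<open>The constant term is dropped since the lower left entry has to vanish at
    \<open>T = 0\<close>. The remainder \<open>1/y - q\<close> is then only integral, which still
    suffices.\<close>
  define q where "q = pCons 0 p'"
  have pq: "Kinf_of_poly p = fls_const e + Kinf_of_poly q"
    by (simp add: p' q_def Kinf_pCons)
  have z: "vge 0 (inverse y - Kinf_of_poly q)"
  proof -
    have "vge 0 ((inverse y - Kinf_of_poly p) + fls_const e)"
      using vge_mono[OF p, of 0] by (intro vge_add) simp_all
    then show ?thesis
      by (simp add: pq)
  qed
  \<comment> \<open>\<open>C\<close> and \<open>D\<close> form the bottom row of the translated
    matrix.\<close>
  define C where "C = 1 - Kinf_of_poly q * y"
  define D where "D = - (Kinf_of_poly q * ppow n)"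
  have "C = y * (inverse y - Kinf_of_poly q)"
    using y0 by (simp add: C_def algebra_simps)
  moreover have "vge s y"
    by (simp add: s_def vge_iff)
  ultimately have C: "vge s C"
    using z vge_mult_0' by metis
  have nth: "fls_nth (Kinf_of_poly q) i = fls_nth (inverse y) i" if "i < 0" for i
    using z that by (simp add: vge_def)
  have inv: "inverse y \<noteq> 0" "fls_subdegree (inverse y) = - s"
    using y0 by (simp_all add: s_def)
  then have "fls_nth (inverse y) (- s) \<noteq> 0"
    using nth_fls_subdegree_nonzero by metis
  then have "fls_nth (Kinf_of_poly q) (- s) \<noteq> 0"
    using nth[of "- s"] s by simp
  moreover have "fls_nth (Kinf_of_poly q) i = 0" if "i < - s" for i
    using nth[of i] s inv that by simp
  ultimately have q: "Kinf_of_poly q \<noteq> 0" "fls_subdegree (Kinf_of_poly q) = - s"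
    by (auto intro: fls_subdegree_eqI)
  have D: "D \<noteq> 0" "fls_subdegree D = n - s"
    using q by (simp_all add: D_def)
  have \<gamma>: "Mat2 1 0 (- q) 1 \<in> Gamma1T"
    by (simp add: Gamma1T_iff q_def)
  define g where "g = Mat2 y (ppow n) C D"
  have g: "mmul (mK (Mat2 1 0 (- q) 1)) (edge_rep n y) = g"
    by (simp add: g_def edge_rep_def C_def D_def Kinf_minus)
  have det: "y * D - ppow n * C = - ppow n"
    by (simp add: C_def D_def algebra_simps)
  have gG: "g \<in> GL2K"
    by (simp add: g_def GL2K_def det)
  have "c (edge_of g) = (\<lambda>_. 0)"
  \<comment> \<open>If \<open>C\<close> dominates, the new level is at most \<open>n - 2 s\<close>
    with \<open>s \<ge> 1\<close>. Otherwise the reversed edge has level \<open>2 s - n - 1\<close>,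
    below \<open>n\<close> because \<open>s \<le> n\<close>.\<close>
  proof (cases "C \<noteq> 0 \<and> fls_subdegree C \<le> n - s")
    case True
    then have "vge (fls_subdegree C) D"
      using D by (simp add: vge_iff)
    then have "edge_of g = edge_of (edge_rep (n - 2 * fls_subdegree C) (y / C))"
      using edge_of_low[of C D y "ppow n"] True by (simp add: g_def det)
    moreover have "s \<le> fls_subdegree C"
      using C True by (simp add: vge_iff)
    ultimately show ?thesis
      using IH s by simp
  next
    case False
    then have "vge (fls_subdegree D + 1) C"
      using D by (auto simp: vge_iff)
    then have "edge_of (reverse_rep g) = edge_of (edge_rep (n - 2 * (n - s) - 1) (ppow n / D))"
      using edge_of_high[of D C y "ppow n"] D by (simp add: g_def det)
    then have "c (edge_of (reverse_rep g)) = (\<lambda>_. 0)"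
      using IH s by simp
    then show ?thesis
      using cocycle_reverse[OF c gG] by (simp add: fun_eq_iff)
  qed
  then show ?thesis
    using cocycle_equivariant_zero[OF c \<gamma>, of "edge_rep n y"] by (simp only: g edge_rep_GL2K)
qed

lemma cocycle_zero_edge_rep:
  assumes c: "c \<in> H k m" and z: "c gamma0 = (\<lambda>_. 0)"
  shows "c (edge_of (edge_rep n y)) = (\<lambda>_. 0)"
proof -
  have "c (edge_of (edge_rep n' y)) = (\<lambda>_. 0)" if "n' \<le> int N" for N n' y
    using that
  proof (induction N arbitrary: n' y)
    case 0
    then show ?case
      using cocycle_zero_nonpos[OF c z, of "nat (- n')" y] by simp
  next
    case (Suc N)
    define n where "n = int N + 1"
    have IH: "c (edge_of (edge_rep n' y')) = (\<lambda>_. 0)" if "n' < n" for n' y'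
      using that Suc.IH by (simp add: n_def)
    have small: "c (edge_of (edge_rep n y')) = (\<lambda>_. 0)" if y': "vge 1 y'" for y'
    proof (cases "vge (n + 1) y'")
      case True
      \<comment> \<open>Division is impossible at \<open>y' = 0\<close>. Instead, harmonicity gives
        its value from level \<open>n - 1\<close> and the \<open>q - 1\<close> other continuations,
        whose points have valuation exactly \<open>n\<close> and are covered by the division
        step.\<close>
      have *: "c (edge_of (edge_rep n (y' + fls_const \<beta> * ppow n))) = (\<lambda>_. 0)" if "\<beta> \<noteq> 0" for \<beta>
      proof (rule cocycle_zero_step[OF c])
        have "vge 1 (fls_const \<beta> * ppow n)"
          by (intro vge_mult_0) (auto simp: n_def)
        then show "vge 1 (y' + fls_const \<beta> * ppow n)"
          using y' by (intro vge_add)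
        have "fls_nth (y' + fls_const \<beta> * ppow n) n \<noteq> 0"
          using True that by (simp add: vge_def ppow_nth)
        then show "\<not> vge (n + 1) (y' + fls_const \<beta> * ppow n)"
          by (auto simp: vge_def)
      qed (use IH in \<open>auto simp: n_def\<close>)
      have "c (edge_of (edge_rep n y')) l = 0" for l
      proof -
        have "0 = (\<Sum>\<beta>\<in>UNIV. c (edge_of (edge_rep n (y' + fls_const \<beta> * ppow n))) l)"
          using cocycle_edge_rep_step[OF c, of n y' l] IH[of "n - 1"] by simp
        also have "\<dots> = c (edge_of (edge_rep n y')) l
            + (\<Sum>\<beta>\<in>UNIV - {0}. c (edge_of (edge_rep n (y' + fls_const \<beta> * ppow n))) l)"
          by (subst sum.remove[of _ 0]) auto
        also have "(\<Sum>\<beta>\<in>UNIV - {0}. c (edge_of (edge_rep n (y' + fls_const \<beta> * ppow n))) l) = 0"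
          by (intro sum.neutral) (auto simp: *)
        finally show ?thesis
          by simp
      qed
      then show ?thesis
        by auto
    next
      case False
      then show ?thesis
        using cocycle_zero_step[OF c _ IH y'] by (simp add: n_def)
    qed
    obtain p where "vge 1 (y - Kinf_of_poly p)"
      by (rule polynomial_part)
    then have "c (edge_of (edge_rep n y)) = (\<lambda>_. 0)"
      by (rule cocycle_translate_zero[OF c small])
    then show ?case
      using IH[of n' y] Suc.prems by (cases "n' = n") (auto simp: n_def)
  qed
  from this[of n "nat n"] show ?thesis
    by simp
qed

text \<open>Comparing the valuations of the two bottom entries brings either the edge or its
  reversal to the form \<open>edge_rep\<close>.\<close>

lemma cocycle_zero:
  assumes c: "c \<in> H k m" and z: "c gamma0 = (\<lambda>_. 0)"
  shows "c E = (\<lambda>_. 0)"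
proof (cases "E \<in> Edges")
  case True
  then obtain g where g: "g \<in> GL2K" "E = edge_of g"
    by (auto simp: Edges_def)
  obtain a b c' d where abcd: "g = Mat2 a b c' d"
    by (cases g)
  have det: "a * d - b * c' \<noteq> 0"
    using g(1) by (simp add: abcd GL2K_def)
  show ?thesis
  proof (cases "c' \<noteq> 0 \<and> vge (fls_subdegree c') d")
    case True
    then show ?thesis
      using edge_of_low[of c' d a b] det by (simp add: g(2) abcd cocycle_zero_edge_rep[OF c z])
  next
    case False
    with det have "d \<noteq> 0" "vge (fls_subdegree d + 1) c'"
      by (auto simp: vge_iff)
    then have "c (edge_of (reverse_rep g)) = (\<lambda>_. 0)"
      using edge_of_high[of d c' a b] det by (simp add: abcd cocycle_zero_edge_rep[OF c z])
    then show ?thesis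
      using cocycle_reverse[OF c g(1)] by (simp add: g(2) fun_eq_iff)
  qed
qed (use cocycle_outside[OF c] in blast)

lemma cocycle_sum:
  assumes c: "\<And>i. i \<in> I \<Longrightarrow> c i \<in> H k m"
  shows "(\<lambda>E l. \<Sum>i\<in>I. s i * c i E l) \<in> H k m"
proof -
  have "(\<Sum>E\<in>edges_into v. \<Sum>i\<in>I. s i * c i E l) = 0" if "v \<in> Vertices" for v l
  proof -
    have "(\<Sum>i\<in>I. s i * (\<Sum>E\<in>edges_into v. c i E l)) = 0"
      using c that by (intro sum.neutral) (simp add: harmonic_cocycles_def)
    then show ?thesis
      by (subst sum.swap) (simp add: sum_distrib_left)
  qed
  moreover have "(\<Sum>i\<in>I. s i * c i (edge_of (reverse_rep g)) l) = - (\<Sum>i\<in>I. s i * c i (edge_of g) l)"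
    if "g \<in> GL2K" for g l
    by (auto simp: cocycle_reverse[OF c that] simp flip: sum_negf intro!: sum.cong)
  moreover have "(\<lambda>l. \<Sum>i\<in>I. s i * c i (edge_of (mmul (mK \<gamma>) g)) l)
      = act \<iota> k m (mK \<gamma>) (\<lambda>l. \<Sum>i\<in>I. s i * c i (edge_of g) l)"
    if "\<gamma> \<in> Gamma1T" "g \<in> GL2K" for \<gamma> g
    unfolding act_sum by (auto simp: cocycle_equivariant[OF c that] intro!: sum.cong)
  moreover have "(\<lambda>l. \<Sum>i\<in>I. s i * c i E l) \<in> homV k" for E
    using c cocycle_homV by (fastforce simp: homV_def intro!: sum.neutral)
  moreover have "(\<lambda>l. \<Sum>i\<in>I. s i * c i E l) = (\<lambda>_. 0)" if "E \<notin> Edges" for E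
    using c that cocycle_outside by (fastforce intro!: sum.neutral)
  ultimately show ?thesis
    unfolding harmonic_cocycles_def mem_Collect_eq by blast
qed

lemma cocycle_eqI:
  assumes c: "c \<in> H k m" "c' \<in> H k m" and eq: "c gamma0 = c' gamma0"
  shows "c = c'"
proof -
  \<comment> \<open>The difference is written as a sum over \<open>bool\<close> so that
    \<open>cocycle_sum\<close> applies.\<close>
  let ?d = "\<lambda>E l. \<Sum>b\<in>UNIV. (if b then 1 else -1) * (if b then c else c') E l"
  have "?d \<in> H k m"
    using c by (intro cocycle_sum) simp
  then have "?d E = (\<lambda>_. 0)" for E
    by (rule cocycle_zero) (simp add: eq UNIV_bool)
  then show ?thesis
    by (simp add: fun_eq_iff UNIV_bool)
qed

end

section \<open>Power sums over the finite field\<close>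

text \<open>Translation by 1 permutes the field, but adds \<open>q\<close> to the sum of its
  elements.\<close>

lemma of_nat_card_field: "of_nat (card (UNIV :: 'f set)) = (0 :: 'f::{field,finite})"
proof -
  have "(\<Sum>x\<in>UNIV. x) = (\<Sum>x\<in>UNIV. x + (1::'f))"
    by (rule sum.reindex_bij_witness[of _ "\<lambda>x. x + 1" "\<lambda>x. x - 1"]) auto
  then show ?thesis
    by (simp add: sum.distrib)
qed

text \<open>For \<open>0 < e < q - 1\<close> the polynomial \<open>x^e - 1\<close> has too few roots
  to vanish on all nonzero elements. Scaling by an element \<open>g\<close> with
  \<open>g^e \<noteq> 1\<close> multiplies the sum by \<open>g^e\<close> and also preserves
  it.\<close>

lemma sum_power_UNIV:
  assumes "e < card (UNIV :: 'f set) - 1"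
  shows "(\<Sum>x\<in>UNIV. x ^ e) = (0 :: 'f::{field,finite})"
proof (cases "e = 0")
  case True
  then show ?thesis
    by (simp add: of_nat_card_field)
next
  case False
  have "\<exists>g::'f. g \<noteq> 0 \<and> g ^ e \<noteq> 1"
  proof (rule ccontr)
    assume "\<not> ?thesis"
    then have sub: "UNIV - {0} \<subseteq> {x::'f. poly (monom 1 e - 1) x = 0}"
      by (auto simp: poly_monom)
    have deg: "degree (monom 1 e - 1 :: 'f poly) \<le> e"
      by (intro degree_diff_le) (auto simp: degree_monom_le)
    have "coeff (monom 1 e - 1 :: 'f poly) e = 1"
      using False by simp
    then have "(monom 1 e - 1 :: 'f poly) \<noteq> 0"
      by (metis coeff_0 zero_neq_one)
    then have "card {x::'f. poly (monom 1 e - 1) x = 0} \<le> e"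
      using card_poly_roots_bound deg order.trans by blast
    moreover have "card (UNIV - {0::'f}) \<le> card {x::'f. poly (monom 1 e - 1) x = 0}"
      by (intro card_mono sub) simp
    ultimately show False
      using assms by (simp add: card_Diff_singleton)
  qed
  then obtain g :: 'f where g: "g \<noteq> 0" "g ^ e \<noteq> 1"
    by blast
  have "(\<Sum>x\<in>UNIV. x ^ e) = (\<Sum>x\<in>UNIV. (g * x) ^ e)"
    by (rule sum.reindex_bij_witness[of _ "\<lambda>x. g * x" "\<lambda>x. x / g"]) (use g in auto)
  also have "\<dots> = g ^ e * (\<Sum>x\<in>UNIV. x ^ e)"
    by (simp add: power_mult_distrib sum_distrib_left)
  finally show ?thesis
    using g by simp
qed

lemma coeff_linear_power':
  "coeff ([:a, b:] ^ n) i = of_nat (n choose i) * b ^ i * a ^ (n - i)" for a :: "'a::field"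
proof (cases "i \<le> n")
  case False
  then have "coeff ([:a, b:] ^ n) i = 0"
    using degree_linear_powers[of a b n 0 0 0] by (intro coeff_eq_0) simp
  with False show ?thesis
    by (simp add: binomial_eq_0)
qed (rule coeff_linear_poly_power)

section \<open>Existence of harmonic cocycles\<close>

abbreviation w0 :: "'f::field fls mat2" where
  "w0 \<equiv> Mat2 0 1 1 0"

lemma w0_GL2K [simp]: "w0 \<in> GL2K"
  by (simp add: GL2K_def)

section \<open>The orbit of \<open>gamma0\<close> and its reversals\<close>

lemma edge_of_translate:
  assumes "\<gamma> \<in> Gamma1T" "\<gamma>' \<in> Gamma1T"
    and eq: "edge_of (mmul (mK \<gamma>) g) = edge_of (mmul (mK \<gamma>') h)"
  obtains \<delta> where "\<delta> \<in> Gamma1T" "edge_of g = edge_of (mmul (mK \<delta>) h)" "mmul \<gamma> \<delta> = \<gamma>'"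
proof -
  obtain \<epsilon> where \<epsilon>: "\<epsilon> \<in> Gamma1T" "mmul \<gamma> \<epsilon> = mone" "mmul \<epsilon> \<gamma> = mone"
    using assms(1) Gamma1T_inverse by blast
  have "edge_of (mmul (mK \<epsilon>) (mmul (mK \<gamma>) g)) = edge_of (mmul (mK \<epsilon>) (mmul (mK \<gamma>') h))"
    using \<epsilon>(1) eq by (intro edge_of_mmul_cong) auto
  then have "edge_of g = edge_of (mmul (mK (mmul \<epsilon> \<gamma>')) h)"
    by (simp add: \<epsilon>(3) mmap_Kinf_mmul flip: mmul_assoc) (simp add: \<epsilon>(3) flip: mmap_Kinf_mmul)
  moreover have "mmul \<gamma> (mmul \<epsilon> \<gamma>') = \<gamma>'"
    by (simp add: \<epsilon>(2) flip: mmul_assoc)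
  ultimately show thesis
    using that Gamma1T_mmul[OF \<epsilon>(1) assms(2)] by blast
qed

text \<open>Scalars change the valuation of the determinant by an even number and Iwahori elements
  do not change it. The parity is the type of the initial vertex, which reversal flips and
  determinant 1 preserves.\<close>

lemma subdegree_mdet_cong:
  assumes "g \<in> GL2K" "h \<in> GL2K" "edge_of g = edge_of h"
  shows "even (fls_subdegree (mdet g)) \<longleftrightarrow> even (fls_subdegree (mdet h))"
proof -
  obtain l u where lu: "l \<noteq> 0" "u \<in> Iwahori" "h = msmult l (mmul g u)"
    using assms edge_eq_iff by metis
  have u: "mdet u \<noteq> 0" "fls_subdegree (mdet u) = 0"
    using lu(2) GL2O_det Iwahori_subset_GL2O by blast+
  have "mdet h = l * l * (mdet g * mdet u)"
    by (simp add: lu(3) power2_eq_square)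
  then have "fls_subdegree (mdet h) = 2 * fls_subdegree l + fls_subdegree (mdet g)"
    using lu(1) u assms(1) by (simp add: GL2K_def)
  then show ?thesis
    by simp
qed

lemma subdegree_mdet_reverse:
  "g \<in> GL2K \<Longrightarrow> fls_subdegree (mdet (reverse_rep g)) = fls_subdegree (mdet g) + 1"
  by (simp add: reverse_rep_def GL2K_def)

lemma edge_gamma0_no_inversion:
  assumes "\<gamma> \<in> Gamma1T" "\<delta> \<in> Gamma1T"
  shows "edge_of (mmul (mK \<gamma>) w0) \<noteq> edge_of (reverse_rep (mmul (mK \<delta>) w0))"
proof
  assume eq: "edge_of (mmul (mK \<gamma>) w0) = edge_of (reverse_rep (mmul (mK \<delta>) w0))"
  have G: "mmul (mK \<gamma>) w0 \<in> GL2K" "mmul (mK \<delta>) w0 \<in> GL2K"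
    using assms by (auto intro: GL2K_mmul)
  show False
    using subdegree_mdet_cong[OF G(1) reverse_rep_GL2K[OF G(2)] eq] subdegree_mdet_reverse[OF G(2)] assms
    by (simp add: mK_det)
qed

text \<open>All entries of \<open>\<gamma>\<close> are integral, hence constant, and the upper right
  one lies in the maximal ideal, hence is 0. The congruences modulo \<open>T\<close> then fix the
  other three.\<close>

lemma edge_gamma0_stabilizer:
  assumes \<gamma>: "\<gamma> \<in> Gamma1T" and eq: "edge_of w0 = edge_of (mmul (mK \<gamma>) w0)"
  shows "\<gamma> = mone"
proof -
  have "mmul (mK \<gamma>) w0 \<in> GL2K"
    using \<gamma> by (auto intro: GL2K_mmul)
  from edge_eqE[OF eq w0_GL2K this] obtain l u where
    lu: "l \<noteq> 0" "u \<in> Iwahori" "mmul (mK \<gamma>) w0 = msmult l (mmul w0 u)" .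
  obtain a b c d where u: "u = Mat2 a b c d"
    by (cases u)
  obtain p q r s where g: "\<gamma> = Mat2 p q r s"
    by (cases \<gamma>)
  have e: "Kinf_of_poly q = l * c" "Kinf_of_poly p = l * d" "Kinf_of_poly s = l * a" "Kinf_of_poly r = l * b"
    using lu(3) by (simp_all add: g u)
  have "mdet (msmult l u) = 1"
    using arg_cong[OF lu(3), of mdet] \<gamma> by (simp add: mK_det)
  then have "fls_subdegree l = 0"
    using lu Iwahori_subset_GL2O by (intro scalar_unit[of l u]) auto
  then have l: "vge 0 l"
    by (simp add: vge_iff)
  have "vge 1 (Kinf_of_poly q)" "vge 0 (Kinf_of_poly p)" "vge 0 (Kinf_of_poly s)" "vge 0 (Kinf_of_poly r)"
    unfolding e using lu(2) l by (auto simp: u Iwahori_iff GL2O_iff intro!: vge_mult_0)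
  then have "q = 0" "p = [:poly p 0:]" "s = [:poly s 0:]" "r = [:poly r 0:]"
    by (auto simp: vge_1_Kinf dest: vge_0_Kinf)
  then show ?thesis
    using \<gamma> by (auto simp: g Gamma1T_iff one_pCons)
qed

text \<open>Equality would put the lower right entry of \<open>\<gamma>\<close> into the maximal
  ideal, so it would be 0 instead of 1 at \<open>T = 0\<close>. This is the edge at the initial
  vertex of \<open>gamma0\<close> that the upper unipotents do not reach.\<close>

lemma edge_mone_orbit:
  assumes \<gamma>: "\<gamma> \<in> Gamma1T"
  shows "edge_of mone \<noteq> edge_of (mmul (mK \<gamma>) w0)"
proof
  assume eq: "edge_of mone = edge_of (mmul (mK \<gamma>) w0)"
  have "mone \<in> GL2K" "mmul (mK \<gamma>) w0 \<in> GL2K"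
    using \<gamma> by (auto simp: GL2K_def mK_det)
  from edge_eqE[OF eq this] obtain l u where
    lu: "l \<noteq> 0" "u \<in> Iwahori" "mmul (mK \<gamma>) w0 = msmult l u"
    unfolding mmul_mone .
  obtain a b c d where u: "u = Mat2 a b c d"
    by (cases u)
  obtain p q r s where g: "\<gamma> = Mat2 p q r s"
    by (cases \<gamma>)
  have e: "Kinf_of_poly s = l * c"
    using lu(3) by (simp add: g u)
  have "mdet (msmult l u) = - 1"
    using arg_cong[OF lu(3), of mdet] \<gamma> by (simp add: mK_det)
  then have "fls_subdegree l = 0"
    using lu Iwahori_subset_GL2O by (intro scalar_unit[of l u]) auto
  then have l: "vge 0 l"
    by (simp add: vge_iff)
  have "vge 1 (Kinf_of_poly s)"
    unfolding e using lu(2) l by (auto simp: u Iwahori_iff GL2O_iff intro!: vge_mult_0)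
  then show False
    using \<gamma> by (auto simp: vge_1_Kinf g Gamma1T_iff)
qed

text \<open>The counterpart at the terminal vertex; here the upper left entry of
  \<open>\<gamma>\<close> would have to vanish.\<close>

lemma edge_one_orbit:
  assumes \<gamma>: "\<gamma> \<in> Gamma1T"
  shows "edge_of (edge_rep 1 0) \<noteq> edge_of (mmul (mK \<gamma>) (reverse_rep w0))"
proof
  assume eq: "edge_of (edge_rep 1 0) = edge_of (mmul (mK \<gamma>) (reverse_rep w0))"
  have "mmul (mK \<gamma>) (reverse_rep w0) \<in> GL2K"
    using \<gamma> by (auto intro!: GL2K_mmul)
  from edge_eqE[OF eq edge_rep_GL2K this] obtain l u where
    lu: "l \<noteq> 0" "u \<in> Iwahori" "mmul (mK \<gamma>) (reverse_rep w0) = msmult l (mmul (edge_rep 1 0) u)" .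
  obtain a b c d where u: "u = Mat2 a b c d"
    by (cases u)
  obtain p q r s where g: "\<gamma> = Mat2 p q r s"
    by (cases \<gamma>)
  have "Kinf_of_poly p * ppow 1 = l * (ppow 1 * c)"
    using lu(3) by (simp add: g u edge_rep_def reverse_rep_def fls_X_conv_ppow)
  then have e: "Kinf_of_poly p = l * c"
    by simp
  have "mdet (mmul (mK \<gamma>) (reverse_rep w0)) = ppow 1"
    using mK_det[OF \<gamma>] by (simp add: reverse_rep_def fls_X_conv_ppow)
  then have "l\<^sup>2 * (ppow 1 * mdet u) = - ppow 1"
    unfolding lu(3) by (simp add: edge_rep_def) (metis minus_minus)
  then have "ppow 1 * (l\<^sup>2 * mdet u) = ppow 1 * (- 1)"
    by (simp add: mult_ac)
  then have "l\<^sup>2 * mdet u = - 1"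
    by (subst (asm) mult_cancel_left) auto
  then have "mdet (msmult l u) = - 1"
    by simp
  then have "fls_subdegree l = 0"
    using lu Iwahori_subset_GL2O by (intro scalar_unit[of l u]) auto
  then have l: "vge 0 l"
    by (simp add: vge_iff)
  have "vge 1 (Kinf_of_poly p)"
    unfolding e using lu(2) l by (auto simp: u Iwahori_iff GL2O_iff intro!: vge_mult_0)
  then show False
    using \<gamma> by (auto simp: vge_1_Kinf g Gamma1T_iff)
qed

text \<open>Conjugation by the diagonal matrix with entries 1 and \<open>1/T\<close> carries the
  Iwahori subgroup into \<open>GL2O\<close>; \<open>u'\<close> is the conjugate of
  \<open>u\<close>.\<close>

lemma vertex_of_terminal_cong:
  assumes "g \<in> GL2K" "h \<in> GL2K" "edge_of g = edge_of h"
  shows "vertex_of (terminal_vertex_rep g) = vertex_of (terminal_vertex_rep h)"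
proof -
  obtain l u where lu: "l \<noteq> 0" "u \<in> Iwahori" "h = msmult l (mmul g u)"
    using assms edge_eq_iff by metis
  obtain a b c d where u: "u = Mat2 a b c d"
    by (cases u)
  define u' where "u' = Mat2 a (b * fls_X) (c / fls_X) d"
  have c: "fls_X * (c / fls_X) = c"
    by (simp del: fls_divide_X)
  have "mdet u' = mdet u"
    using c by (simp add: u'_def u mult.assoc del: fls_divide_X)
  moreover have "vge 0 (c / fls_X)" "vge 0 (b * fls_X)"
    using lu(2) vge_divide[of 0 fls_X c] vge_mult_0[of b 0 fls_X]
    by (auto simp: u Iwahori_iff GL2O_iff)
  ultimately have u': "u' \<in> GL2O"
    using lu(2) by (simp add: u'_def u Iwahori_iff GL2O_iff del: fls_divide_X)
  have "mmul u (Mat2 1 0 0 fls_X) = mmul (Mat2 1 0 0 fls_X) u'"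
    using c by (simp add: u u'_def mult.commute del: fls_divide_X)
  then have "terminal_vertex_rep h = msmult l (mmul (terminal_vertex_rep g) u')"
    by (simp add: terminal_vertex_rep_def lu(3) mmul_assoc)
  moreover have "terminal_vertex_rep g \<in> GL2K" "terminal_vertex_rep h \<in> GL2K"
    using assms by (auto simp: terminal_vertex_rep_def GL2K_def)
  ultimately show ?thesis
    using lu(1) u' vertex_eq_iff by metis
qed

section \<open>Construction of a cocycle with prescribed value at \<open>gamma0\<close>\<close>

context laurent_embedding
begin

lemma sum_const_power:
  "e < card (UNIV :: 'f set) - 1 \<Longrightarrow> (\<Sum>b\<in>UNIV. \<iota> (fls_const b) ^ e) = 0"
proof -
  have const_sum: "fls_const (\<Sum>b\<in>B. g b) = (\<Sum>b\<in>B. fls_const (g b))" for B and g :: "'f \<Rightarrow> 'f"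
    by (induction B rule: infinite_finite_induct) (simp_all flip: fls_plus_const)
  assume "e < card (UNIV :: 'f set) - 1"
  then have "\<iota> (fls_const (\<Sum>b\<in>UNIV. b ^ e)) = 0"
    by (simp add: sum_power_UNIV hom_zero)
  then show ?thesis
    by (simp add: const_sum hom_sum hom_power fls_const_power)
qed

lemma sum_pairing: "(\<Sum>b\<in>B. pairing n w (p b)) = pairing n w (\<Sum>b\<in>B. p b)"
  using pairing_sum_smult[of n w "\<lambda>_. 1" p B] by simp

text \<open>Each coefficient of \<open>(x + b)^j\<close> is a multiple of a power of
  \<open>b\<close> of exponent at most \<open>k - 2 < q - 1\<close>.\<close>

lemma sum_act_upper:
  assumes k: "2 \<le> k" "k \<le> card (UNIV :: 'f set)"
  shows "(\<Sum>b\<in>UNIV. act \<iota> k m (Mat2 1 (fls_const b) 0 1) w j) = 0"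
proof -
  have one: "[:1::'c:] ^ n = 1" for n
    by (simp flip: one_pCons)
  have "(\<Sum>b\<in>UNIV. [:\<iota> (fls_const b), 1:] ^ j) = 0" if "j \<le> k - 2"
  proof (rule poly_eqI)
    fix l
    have "(\<Sum>b\<in>UNIV. coeff ([:\<iota> (fls_const b), 1:] ^ j) l)
        = (\<Sum>b\<in>UNIV. of_nat (j choose l) * \<iota> (fls_const b) ^ (j - l))"
      by (simp add: coeff_linear_power')
    also have "\<dots> = 0"
      using that k by (simp add: sum_const_power flip: sum_distrib_left)
    finally show "coeff (\<Sum>b\<in>UNIV. [:\<iota> (fls_const b), 1:] ^ j) l = coeff 0 l"
      by (simp add: coeff_sum)
  qed
  then show ?thesis
    by (cases "j \<le> k - 2") (simp_all add: act_eq_pairing hom_one hom_zero sum_pairing one, simp add: pairing_def)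
qed

text \<open>The same for powers of \<open>1 + b t x\<close>. The case used is \<open>t = T\<close>,
  because lower unipotents in \<open>Gamma1T\<close> have a lower left entry divisible by
  \<open>T\<close>.\<close>

lemma sum_act_lower:
  assumes k: "2 \<le> k" "k \<le> card (UNIV :: 'f set)"
  shows "(\<Sum>b\<in>UNIV. act \<iota> k m (Mat2 1 0 (fls_const b * t) 1) w j) = 0"
proof -
  have "(\<Sum>b\<in>UNIV. [:1, \<iota> (fls_const b * t):] ^ r) = 0" if "r \<le> k - 2" for r
  proof (rule poly_eqI)
    fix l
    have "(\<Sum>b\<in>UNIV. coeff ([:1, \<iota> (fls_const b * t):] ^ r) l)
        = (\<Sum>b\<in>UNIV. of_nat (r choose l) * \<iota> t ^ l * \<iota> (fls_const b) ^ l)"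
      by (simp add: coeff_linear_power' hom_mult power_mult_distrib mult_ac)
    also have "\<dots> = of_nat (r choose l) * \<iota> t ^ l * (\<Sum>b\<in>UNIV. \<iota> (fls_const b) ^ l)"
      by (simp add: sum_distrib_left)
    also have "\<dots> = 0"
      using that k sum_const_power[of l] by (cases "l \<le> r") (auto simp: binomial_eq_0)
    finally show "coeff (\<Sum>b\<in>UNIV. [:1, \<iota> (fls_const b * t):] ^ r) l = coeff 0 l"
      by (simp add: coeff_sum)
  qed
  then have "(\<Sum>b\<in>UNIV. [:0, 1:] ^ j * [:1, \<iota> (fls_const b * t):] ^ (k - 2 - j)) = 0"
    by (simp flip: sum_distrib_left)
  then show ?thesis
    by (cases "j \<le> k - 2") (simp_all add: act_eq_pairing hom_one hom_zero sum_pairing, simp add: pairing_def)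
qed

text \<open>The descriptions are unique because the stabilizer of \<open>gamma0\<close> is trivial,
  and the order of the two cases is harmless because no edge of the orbit is reversed by
  \<open>Gamma1T\<close>.\<close>

definition cocycle_of :: "nat \<Rightarrow> int \<Rightarrow> (nat \<Rightarrow> 'c) \<Rightarrow> 'f fls mat2 set \<Rightarrow> nat \<Rightarrow> 'c" where
  "cocycle_of k m w E =
     (if \<exists>\<gamma>\<in>Gamma1T. E = edge_of (mmul (mK \<gamma>) w0)
      then act \<iota> k m (mK (THE \<gamma>. \<gamma> \<in> Gamma1T \<and> E = edge_of (mmul (mK \<gamma>) w0))) w
      else if \<exists>\<gamma>\<in>Gamma1T. E = edge_of (reverse_rep (mmul (mK \<gamma>) w0))
      then (\<lambda>l. - act \<iota> k m (mK (THE \<gamma>. \<gamma> \<in> Gamma1T \<and> E = edge_of (reverse_rep (mmul (mK \<gamma>) w0)))) w l)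
      else (\<lambda>_. 0))"

lemma orbit_inj:
  assumes "\<gamma> \<in> Gamma1T" "\<delta> \<in> Gamma1T" "edge_of (mmul (mK \<gamma>) w0) = edge_of (mmul (mK \<delta>) (w0 :: 'f fls mat2))"
  shows "\<gamma> = \<delta>"
  using edge_of_translate[OF assms] edge_gamma0_stabilizer by (metis mmul_mone(2))

lemma cocycle_of_orbit:
  assumes "\<gamma> \<in> Gamma1T"
  shows "cocycle_of k m w (edge_of (mmul (mK \<gamma>) w0)) = act \<iota> k m (mK \<gamma>) w"
proof -
  have "(THE \<delta>. \<delta> \<in> Gamma1T \<and> edge_of (mmul (mK \<gamma>) w0) = edge_of (mmul (mK \<delta>) (w0 :: 'f fls mat2))) = \<gamma>"
    using assms orbit_inj by (intro the_equality) auto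
  moreover have "\<exists>\<delta>\<in>Gamma1T. edge_of (mmul (mK \<gamma>) w0) = edge_of (mmul (mK \<delta>) (w0 :: 'f fls mat2))"
    using assms by blast
  ultimately show ?thesis
    by (simp only: cocycle_of_def if_True)
qed

lemma cocycle_of_reverse_orbit:
  assumes "\<gamma> \<in> Gamma1T"
  shows "cocycle_of k m w (edge_of (reverse_rep (mmul (mK \<gamma>) w0))) = (\<lambda>l. - act \<iota> k m (mK \<gamma>) w l)"
proof -
  have "\<delta> = \<gamma>" if "\<delta> \<in> Gamma1T"
    "edge_of (reverse_rep (mmul (mK \<gamma>) w0)) = edge_of (reverse_rep (mmul (mK \<delta>) (w0 :: 'f fls mat2)))" for \<delta>
  proof -
    have "mmul (mK \<gamma>) w0 \<in> GL2K" "mmul (mK \<delta>) w0 \<in> GL2K"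
      using assms that(1) by (auto intro: GL2K_mmul)
    then have "edge_of (mmul (mK \<gamma>) w0) = edge_of (mmul (mK \<delta>) (w0 :: 'f fls mat2))"
      using that(2) edge_of_reverse_eq_iff by blast
    then show ?thesis
      using orbit_inj assms that(1) by blast
  qed
  then have "(THE \<delta>. \<delta> \<in> Gamma1T \<and> edge_of (reverse_rep (mmul (mK \<gamma>) w0))
      = edge_of (reverse_rep (mmul (mK \<delta>) (w0 :: 'f fls mat2)))) = \<gamma>"
    by (intro the_equality conjI assms refl) (elim conjE)
  moreover have "\<not> (\<exists>\<delta>\<in>Gamma1T. edge_of (reverse_rep (mmul (mK \<gamma>) w0)) = edge_of (mmul (mK \<delta>) (w0 :: 'f fls mat2)))"
  proof (intro notI, elim bexE)
    fix \<delta> :: "'f poly mat2"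
    assume "\<delta> \<in> Gamma1T" "edge_of (reverse_rep (mmul (mK \<gamma>) w0)) = edge_of (mmul (mK \<delta>) (w0 :: 'f fls mat2))"
    then show False
      using edge_gamma0_no_inversion[of \<delta> \<gamma>] assms by metis
  qed
  moreover have "\<exists>\<delta>\<in>Gamma1T. edge_of (reverse_rep (mmul (mK \<gamma>) w0))
      = edge_of (reverse_rep (mmul (mK \<delta>) (w0 :: 'f fls mat2)))"
    using assms by blast
  ultimately show ?thesis
    by (simp only: cocycle_of_def if_True if_False)
qed

lemma cocycle_of_outside:
  assumes "\<And>\<gamma>. \<gamma> \<in> Gamma1T \<Longrightarrow> E \<noteq> edge_of (mmul (mK \<gamma>) w0)"
    and "\<And>\<gamma>. \<gamma> \<in> Gamma1T \<Longrightarrow> E \<noteq> edge_of (reverse_rep (mmul (mK \<gamma>) w0))"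
  shows "cocycle_of k m w E = (\<lambda>_. 0)"
proof -
  have "\<not> (\<exists>\<gamma>\<in>Gamma1T. E = edge_of (mmul (mK \<gamma>) w0))"
    "\<not> (\<exists>\<gamma>\<in>Gamma1T. E = edge_of (reverse_rep (mmul (mK \<gamma>) w0)))"
    using assms by blast+
  then show ?thesis
    unfolding cocycle_of_def by simp
qed

lemma edge_cases [case_names orbit reverse outside]:
  obtains \<gamma> where "\<gamma> \<in> Gamma1T" "E = edge_of (mmul (mK \<gamma>) w0)"
  | \<gamma> where "\<gamma> \<in> Gamma1T" "E = edge_of (reverse_rep (mmul (mK \<gamma>) w0))"
  | "\<And>\<gamma>. \<gamma> \<in> Gamma1T \<Longrightarrow> E \<noteq> edge_of (mmul (mK \<gamma>) w0)"
    "\<And>\<gamma>. \<gamma> \<in> Gamma1T \<Longrightarrow> E \<noteq> edge_of (reverse_rep (mmul (mK \<gamma>) w0))"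
  by blast

lemma cocycle_of_homV: "cocycle_of k m w E \<in> homV k"
  using act_homV[of k m _ w] by (cases E rule: edge_cases)
    (auto simp: cocycle_of_orbit cocycle_of_reverse_orbit cocycle_of_outside homV_def)

lemma cocycle_of_not_edge: "E \<notin> Edges \<Longrightarrow> cocycle_of k m w E = (\<lambda>_. 0)"
proof (rule cocycle_of_outside)
  fix \<gamma> :: "'f poly mat2"
  assume "E \<notin> Edges" "\<gamma> \<in> Gamma1T"
  moreover have "mmul (mK \<gamma>) w0 \<in> GL2K" if "\<gamma> \<in> Gamma1T"
    using that by (auto intro: GL2K_mmul)
  ultimately show "E \<noteq> edge_of (mmul (mK \<gamma>) w0)" "E \<noteq> edge_of (reverse_rep (mmul (mK \<gamma>) w0))"
    by (auto simp: Edges_def)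
qed

lemma cocycle_of_reverse:
  assumes g: "g \<in> GL2K"
  shows "cocycle_of k m w (edge_of (reverse_rep g)) = (\<lambda>l. - cocycle_of k m w (edge_of g) l)"
proof -
  have G: "mmul (mK \<gamma>) w0 \<in> GL2K" if "\<gamma> \<in> Gamma1T" for \<gamma> :: "'f poly mat2"
    using that by (auto intro: GL2K_mmul)
  show ?thesis
  proof (cases "edge_of g" rule: edge_cases)
    case (orbit \<gamma>)
    then have "edge_of (reverse_rep g) = edge_of (reverse_rep (mmul (mK \<gamma>) w0))"
      using g G edge_of_reverse_cong by blast
    then show ?thesis
      using orbit by (simp add: cocycle_of_orbit cocycle_of_reverse_orbit)
  next
    case (reverse \<gamma>)
    then have "edge_of (reverse_rep g) = edge_of (reverse_rep (reverse_rep (mmul (mK \<gamma>) w0)))"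
      using g G edge_of_reverse_cong by blast
    then show ?thesis
      using reverse G by (simp add: edge_of_reverse_reverse cocycle_of_orbit cocycle_of_reverse_orbit)
  next
    case outside
    have "cocycle_of k m w (edge_of (reverse_rep g)) = (\<lambda>_. 0)"
    proof (rule cocycle_of_outside)
      fix \<gamma> :: "'f poly mat2"
      assume \<gamma>: "\<gamma> \<in> Gamma1T"
      show "edge_of (reverse_rep g) \<noteq> edge_of (mmul (mK \<gamma>) w0)"
      proof
        assume "edge_of (reverse_rep g) = edge_of (mmul (mK \<gamma>) w0)"
        then have "edge_of (reverse_rep (reverse_rep g)) = edge_of (reverse_rep (mmul (mK \<gamma>) w0))"
          using g G[OF \<gamma>] edge_of_reverse_cong by blast
        then show False
          using outside(2)[OF \<gamma>] g by (simp add: edge_of_reverse_reverse)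
      qed
      show "edge_of (reverse_rep g) \<noteq> edge_of (reverse_rep (mmul (mK \<gamma>) w0))"
        using outside(1)[OF \<gamma>] g G[OF \<gamma>] by (simp add: edge_of_reverse_eq_iff)
    qed
    then show ?thesis
      using cocycle_of_outside[OF outside] by simp
  qed
qed

lemma cocycle_of_equivariant:
  assumes \<gamma>: "\<gamma> \<in> Gamma1T" and g: "g \<in> GL2K"
  shows "cocycle_of k m w (edge_of (mmul (mK \<gamma>) g)) = act \<iota> k m (mK \<gamma>) (cocycle_of k m w (edge_of g))"
proof -
  have K: "mK \<gamma> \<in> GL2K"
    using \<gamma> by auto
  show ?thesis
  proof (cases "edge_of g" rule: edge_cases)
    case (orbit \<delta>)
    then have "edge_of (mmul (mK \<gamma>) g) = edge_of (mmul (mK (mmul \<gamma> \<delta>)) w0)"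
      using edge_of_mmul_cong[OF K, of g "mmul (mK \<delta>) w0"] by (simp add: mmap_Kinf_mmul mmul_assoc)
    then show ?thesis
      using cocycle_of_orbit[OF orbit(1)] cocycle_of_orbit[OF Gamma1T_mmul[OF \<gamma> orbit(1)]]
      by (simp only: orbit(2) act_mmul mmap_Kinf_mmul)
  next
    case (reverse \<delta>)
    then have "edge_of (mmul (mK \<gamma>) g) = edge_of (reverse_rep (mmul (mK (mmul \<gamma> \<delta>)) w0))"
      using edge_of_mmul_cong[OF K, of g "reverse_rep (mmul (mK \<delta>) w0)"]
      by (simp add: mmap_Kinf_mmul mmul_assoc reverse_rep_mmul)
    then show ?thesis
      using cocycle_of_reverse_orbit[OF reverse(1)]
        cocycle_of_reverse_orbit[OF Gamma1T_mmul[OF \<gamma> reverse(1)]]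
      by (simp only: reverse(2) act_mmul mmap_Kinf_mmul act_minus)
  next
    case outside
    have "cocycle_of k m w (edge_of (mmul (mK \<gamma>) g)) = (\<lambda>_. 0)"
    proof (rule cocycle_of_outside)
      fix \<delta> :: "'f poly mat2"
      assume \<delta>: "\<delta> \<in> Gamma1T"
      show "edge_of (mmul (mK \<gamma>) g) \<noteq> edge_of (mmul (mK \<delta>) w0)"
        using edge_of_translate[OF \<gamma> \<delta>, of g w0] outside(1) by metis
      show "edge_of (mmul (mK \<gamma>) g) \<noteq> edge_of (reverse_rep (mmul (mK \<delta>) w0))"
        using edge_of_translate[OF \<gamma> \<delta>, of g "reverse_rep w0"] outside(2)
        unfolding reverse_rep_mmul by metis
    qed
    then show ?thesis
      using cocycle_of_outside[OF outside] by (simp add: act_zero)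
  qed
qed

lemma cocycle_of_mone: "cocycle_of k m w (edge_of mone) = (\<lambda>_. 0)"
proof (rule cocycle_of_outside)
  fix \<gamma> :: "'f poly mat2"
  assume \<gamma>: "\<gamma> \<in> Gamma1T"
  show "edge_of mone \<noteq> edge_of (mmul (mK \<gamma>) w0)"
    by (rule edge_mone_orbit[OF \<gamma>])
  have G: "mmul (mK \<gamma>) w0 \<in> GL2K" "mone \<in> GL2K"
    using \<gamma> by (auto simp: GL2K_def mK_det)
  show "edge_of mone \<noteq> edge_of (reverse_rep (mmul (mK \<gamma>) w0))"
    using subdegree_mdet_cong[OF G(2) reverse_rep_GL2K[OF G(1)]] subdegree_mdet_reverse[OF G(1)] \<gamma>
    by (auto simp: mK_det)
qed

lemma cocycle_of_one: "cocycle_of k m w (edge_of (edge_rep 1 0)) = (\<lambda>_. 0)"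
proof (rule cocycle_of_outside)
  fix \<gamma> :: "'f poly mat2"
  assume \<gamma>: "\<gamma> \<in> Gamma1T"
  have G: "mmul (mK \<gamma>) w0 \<in> GL2K"
    using \<gamma> by (auto intro: GL2K_mmul)
  show "edge_of (edge_rep 1 0) \<noteq> edge_of (mmul (mK \<gamma>) w0)"
    using subdegree_mdet_cong[of "edge_rep 1 0", OF edge_rep_GL2K G] \<gamma>
    by (auto simp: mK_det edge_rep_def)
  show "edge_of (edge_rep 1 0) \<noteq> edge_of (reverse_rep (mmul (mK \<gamma>) w0))"
    using edge_one_orbit[OF \<gamma>] by (simp add: reverse_rep_mmul)
qed

lemma cocycle_of_harmonic:
  assumes k: "2 \<le> k" "k \<le> card (UNIV :: 'f set)"
  shows "cocycle_of k m w \<in> H k m"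
proof -
  let ?c = "cocycle_of k m w"
  have star: "(\<Sum>E\<in>edges_into (vertex_of h). ?c E l)
      = - (?c (edge_of h) l + (\<Sum>\<beta>\<in>UNIV. ?c (edge_of (mmul h (nbr \<beta>))) l))" if "h \<in> GL2K" for h l
    using that by (simp add: sum_edges_into cocycle_of_reverse GL2K_mmul nbr_GL2K sum_negf)
  \<comment> \<open>A nonzero summand forces \<open>v\<close> to be the terminal vertex of a
    translate of \<open>gamma0\<close> or of its reversal. With no nonzero summand there is nothing
    to show.\<close>
  have "(\<Sum>E\<in>edges_into v. ?c E l) = 0" for v l
  proof (cases "\<exists>E\<in>edges_into v. ?c E l \<noteq> 0")
    case True
    then obtain g where g: "g \<in> GL2K" "vertex_of (terminal_vertex_rep g) = v" "?c (edge_of g) l \<noteq> 0"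
      by (auto simp: edges_into_def)
    have v: "v = vertex_of (terminal_vertex_rep h)" if "edge_of g = edge_of h" "h \<in> GL2K" for h
      using vertex_of_terminal_cong g that by blast
    have G: "mmul (mK \<gamma>) w0 \<in> GL2K" if "\<gamma> \<in> Gamma1T" for \<gamma> :: "'f poly mat2"
      using that by (auto intro: GL2K_mmul)
    show ?thesis
    proof (cases "edge_of g" rule: edge_cases)
      case (orbit \<gamma>)
      \<comment> \<open>\<open>edge_rep 1 0\<close> represents the terminal vertex of
        \<open>gamma0\<close>. Among the edges leaving it, the one represented by the same matrix
        has value 0.\<close>
      define h where "h = mmul (mK \<gamma>) (edge_rep 1 0)"
      have hG: "h \<in> GL2K"
        unfolding h_def using orbit(1) by auto
      have "terminal_vertex_rep (mmul (mK \<gamma>) w0) = h"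
        by (simp add: terminal_vertex_rep_def mmul_assoc h_def edge_rep_def fls_X_conv_ppow)
      then have vh: "v = vertex_of h"
        using v[OF orbit(2) G[OF orbit(1)]] by simp
      have "?c (edge_of h) = (\<lambda>_. 0)"
        using cocycle_of_equivariant[OF orbit(1), of "edge_rep 1 0"]
        by (simp add: h_def cocycle_of_one act_zero)
      moreover have "?c (edge_of (mmul h (nbr \<beta>)))
          = (\<lambda>l. - act \<iota> k m (mK \<gamma>) (act \<iota> k m (Mat2 1 0 (fls_const \<beta> * fls_X_inv) 1) w) l)" for \<beta>
      proof -
        \<comment> \<open>The lower unipotent with entry \<open>\<beta> T\<close> carries the
          reversal of \<open>gamma0\<close> to the edge of index \<open>\<beta>\<close>.\<close>
        define \<delta> where "\<delta> = Mat2 1 0 [:0, \<beta>:] 1"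
        have d: "mK \<delta> = Mat2 1 0 (fls_const \<beta> * fls_X_inv) 1"
          by (simp only: \<delta>_def mmap.simps Kinf_1 Kinf_0 Kinf_pCons fls_const_0 add_0 mult_zero_right
              add_0_right mult.commute)
        have "fls_X_inv * fls_X = (1 :: 'f fls)"
          by (metis fls_X_nonzero fls_inverse_X left_inverse)
        then have X: "fls_const \<beta> * fls_X_inv * fls_X = fls_const \<beta>"
          by (simp only: mult.assoc mult_1_right)
        have "mmul (edge_rep 1 0) (nbr \<beta>) = mmul (mK \<delta>) (reverse_rep w0)"
          unfolding d edge_rep_def nbr_def reverse_rep_def fls_X_conv_ppow[symmetric]
          by (simp add: X del: fls_X_times_comm)
        then have "mmul h (nbr \<beta>) = reverse_rep (mmul (mK (mmul \<gamma> \<delta>)) w0)"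
          by (simp add: h_def mmul_assoc mmap_Kinf_mmul reverse_rep_mmul)
        moreover have "\<delta> \<in> Gamma1T"
          by (simp add: \<delta>_def)
        ultimately show ?thesis
          using cocycle_of_reverse_orbit[OF Gamma1T_mmul[OF orbit(1)], of \<delta>]
          by (simp only: act_mmul mmap_Kinf_mmul d)
      qed
      moreover have "(\<Sum>\<beta>\<in>UNIV. act \<iota> k m (mK \<gamma>) (act \<iota> k m (Mat2 1 0 (fls_const \<beta> * fls_X_inv) 1) w) l) = 0"
        using act_sum[of k m "mK \<gamma>" "\<lambda>_. 1" "\<lambda>\<beta>. act \<iota> k m (Mat2 1 0 (fls_const \<beta> * fls_X_inv) 1) w" UNIV]
        by (simp add: sum_act_lower[OF k] act_zero fun_eq_iff)
      ultimately show ?thesis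
        unfolding vh star[OF hG] by (simp add: sum_negf)
    next
      case (reverse \<gamma>)
      have KG: "mK \<gamma> \<in> GL2K"
        using reverse(1) by auto
      \<comment> \<open>The reversal ends where \<open>gamma0\<close> starts, at the class of the
        identity, so \<open>v\<close> is the class of \<open>\<gamma>\<close>.\<close>
      have "terminal_vertex_rep (reverse_rep (mmul (mK \<gamma>) w0)) = mmul (mK \<gamma>) (msmult fls_X mone)"
        by (simp add: terminal_vertex_rep_def reverse_rep_def mmul_assoc)
      also have "\<dots> = msmult fls_X (mK \<gamma>)"
        by (simp only: mmul_msmult mmul_mone)
      finally have "v = vertex_of (msmult fls_X (mK \<gamma>))"
        using v[OF reverse(2)] G[OF reverse(1)] by auto
      moreover have "vertex_of (mK \<gamma>) = vertex_of (msmult fls_X (mK \<gamma>))"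
        unfolding vertex_eq_iff[OF KG GL2K_msmult[OF fls_X_nonzero KG]]
        by (intro exI[of _ fls_X] exI[of _ mone]) (simp add: GL2O_iff)
      ultimately have vh: "v = vertex_of (mK \<gamma>)"
        by simp
      have "mone \<in> GL2K"
        by (simp add: GL2K_def)
      then have "?c (edge_of (mK \<gamma>)) = (\<lambda>_. 0)"
        using cocycle_of_equivariant[OF reverse(1), of mone k m w]
        by (simp add: cocycle_of_mone act_zero)
      moreover have "?c (edge_of (mmul (mK \<gamma>) (nbr \<beta>)))
          = act \<iota> k m (mK \<gamma>) (act \<iota> k m (Mat2 1 (fls_const \<beta>) 0 1) w)" for \<beta>
      proof -
        define \<delta> where "\<delta> = Mat2 1 [:\<beta>:] 0 1"
        have d: "mK \<delta> = Mat2 1 (fls_const \<beta>) 0 1"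
          by (simp add: \<delta>_def Kinf_const)
        have "mmul (mK \<gamma>) (nbr \<beta>) = mmul (mK (mmul \<gamma> \<delta>)) w0"
          unfolding mmap_Kinf_mmul d mmul_assoc by (simp add: nbr_def)
        moreover have "\<delta> \<in> Gamma1T"
          by (simp add: \<delta>_def)
        ultimately show ?thesis
          using cocycle_of_orbit[OF Gamma1T_mmul[OF reverse(1)], of \<delta>]
          by (simp only: act_mmul mmap_Kinf_mmul d)
      qed
      moreover have "(\<Sum>\<beta>\<in>UNIV. act \<iota> k m (mK \<gamma>) (act \<iota> k m (Mat2 1 (fls_const \<beta>) 0 1) w) l) = 0"
        using act_sum[of k m "mK \<gamma>" "\<lambda>_. 1" "\<lambda>\<beta>. act \<iota> k m (Mat2 1 (fls_const \<beta>) 0 1) w" UNIV]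
        by (simp add: sum_act_upper[OF k] act_zero fun_eq_iff)
      ultimately show ?thesis
        unfolding vh star[OF KG] by simp
    next
      case outside
      then show ?thesis
        using g(3) cocycle_of_outside by metis
    qed
  qed (simp add: sum.neutral)
  then show ?thesis
    unfolding harmonic_cocycles_def
    using cocycle_of_homV cocycle_of_not_edge cocycle_of_equivariant cocycle_of_reverse by auto
qed

lemma cocycle_of_gamma0: "w \<in> homV k \<Longrightarrow> cocycle_of k m w gamma0 = w"
  using cocycle_of_orbit[of mone k m w] by (simp add: gamma0_def act_mone)

end

section \<open>Hecke operators\<close>

text \<open>The index \<^const>\<open>None\<close> stands for the first representative in the definition of the Hecke
  operator, \<open>Some b\<close> for the one with parameter \<open>b\<close>.\<close>

fun hecke_mat :: "'f::field poly \<Rightarrow> 'f option \<Rightarrow> 'f poly mat2" where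
  "hecke_mat P None = Mat2 P 0 0 1"
| "hecke_mat P (Some b) = Mat2 1 ([:b:] * (1 - P)) 0 P"

lemma mdet_hecke_mat [simp]: "mdet (hecke_mat P i) = P"
  by (cases i) simp_all

lemma Kinf_power: "Kinf_of_poly (p ^ n) = Kinf_of_poly p ^ n"
  by (induction n) (simp_all add: Kinf_mult)

lemma Kinf_of_nat: "Kinf_of_poly (of_nat n) = of_nat n"
  by (induction n) (simp_all add: Kinf_add)

lemma Kinf_sum: "Kinf_of_poly (sum p I) = (\<Sum>i\<in>I. Kinf_of_poly (p i))"
  by (induction I rule: infinite_finite_induct) (simp_all add: Kinf_add)

lemma subdegree_Kinf: "p \<noteq> 0 \<Longrightarrow> fls_subdegree (Kinf_of_poly p) = - int (degree p)"
  by (rule fls_subdegree_eqI) (auto simp: Kinf_nth coeff_eq_0)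

text \<open>This replaces congruences modulo \<open>P\<close> by equations between values at its
  root.\<close>

lemma linear_root:
  fixes P :: "'f::field poly"
  assumes "degree P = 1"
  obtains t where "\<And>p. P dvd p \<longleftrightarrow> poly p t = 0"
proof -
  obtain b a where P: "P = [:a, b:]" "b \<noteq> 0"
    by (rule degree1_coeffs[OF assms])
  define t where "t = - a / b"
  have "P = smult b [:- t, 1:]"
    using P by (simp add: t_def)
  then have "P dvd p \<longleftrightarrow> poly p t = 0" for p
    using P(2) by (simp only: smult_dvd_iff poly_eq_0_iff_dvd if_False)
  then show thesis
    by (rule that)
qed

text \<open>Modulo \<open>P\<close>, the rows of \<open>hecke_mat P i * \<gamma>\<close> span a line; \<open>j\<close> is its slope.\<close>

lemma hecke_mat_permute:
  fixes P :: "'f::field poly"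
  assumes P: "degree P = 1" "poly P 0 = 1" and \<gamma>: "\<gamma> \<in> Gamma1T"
  shows "\<exists>j. \<exists>\<delta>\<in>Gamma1T. mmul (hecke_mat P i) \<gamma> = mmul \<delta> (hecke_mat P j)"
proof -
  obtain t where t: "\<And>p. P dvd p \<longleftrightarrow> poly p t = 0"
    using linear_root[OF P(1)] by metis
  have Pt: "poly P t = 0"
    using t[of P] by simp
  have P0: "P \<noteq> 0"
    using P(1) by auto
  obtain p q r s where M: "mmul (hecke_mat P i) \<gamma> = Mat2 p q r s"
    by (cases "mmul (hecke_mat P i) \<gamma>")
  have "mdet (mmul (hecke_mat P i) \<gamma>) = P"
    using \<gamma> by (cases \<gamma>) (simp only: mdet_mmul mdet_hecke_mat, simp add: Gamma1T_iff)
  then have det: "p * s - q * r = P"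
    by (simp add: M)
  obtain a b c d where abcd: "\<gamma> = Mat2 a b c d"
    by (cases \<gamma>)
  \<comment> \<open>Every \<open>hecke_mat P i\<close> is the identity at \<open>T = 0\<close>; this
    is why the cofactor below satisfies the congruences of \<open>Gamma1T\<close>.\<close>
  have at0: "poly p 0 = 1" "poly r 0 = 0" "poly s 0 = 1"
    using M \<gamma> P(2) by (cases i; auto simp: abcd Gamma1T_iff)+
  have dett: "poly p t * poly s t = poly q t * poly r t"
    using arg_cong[OF det, of "\<lambda>p. poly p t"] Pt by simp
  show ?thesis
  proof (cases "poly p t = 0 \<and> poly r t = 0")
    case True
    then have "P dvd p" "P dvd r"
      using t by simp_all
    then obtain p' r' where pr: "p = P * p'" "r = P * r'"
      unfolding dvd_def by blast
    have "P * (p' * s - q * r') = P * 1"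
      using det by (simp add: pr algebra_simps)
    then have "p' * s - q * r' = 1"
      by (simp only: mult_left_cancel[OF P0])
    then have "Mat2 p' q r' s \<in> Gamma1T"
      using at0 P(2) by (simp add: Gamma1T_iff pr)
    moreover have "mmul (hecke_mat P i) \<gamma> = mmul (Mat2 p' q r' s) (hecke_mat P None)"
      by (simp add: M pr mult.commute)
    ultimately show ?thesis
      by blast
  next
    case False
    obtain \<beta> where \<beta>: "poly q t = poly p t * \<beta>" "poly s t = poly r t * \<beta>"
    proof (cases "poly p t = 0")
      case True
      with False dett that[of "poly s t / poly r t"] show thesis
        by auto
    next
      case False
      with dett that[of "poly q t / poly p t"] show thesis
        by (simp add: field_simps)
    qed
    \<comment> \<open>At the root of \<open>P\<close> the factor \<open>1 - P\<close> equals 1, so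
      \<open>\<beta>\<close> is the required parameter.\<close>
    have "P dvd q - p * ([:\<beta>:] * (1 - P))" "P dvd s - r * ([:\<beta>:] * (1 - P))"
      by (simp_all add: t \<beta> Pt)
    then obtain q' s' where "q - p * ([:\<beta>:] * (1 - P)) = P * q'" "s - r * ([:\<beta>:] * (1 - P)) = P * s'"
      unfolding dvd_def by blast
    then have qs: "q = p * ([:\<beta>:] * (1 - P)) + q' * P" "s = r * ([:\<beta>:] * (1 - P)) + s' * P"
      by (simp_all only: diff_eq_eq mult.commute add.commute)
    have "P * (p * s' - q' * r) = P * 1"
      using det unfolding qs by (simp only: ring_distribs mult_ac) (simp add: algebra_simps)
    then have "p * s' - q' * r = 1"
      by (simp only: mult_left_cancel[OF P0])
    moreover have "poly s' 0 = 1"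
      using at0 P(2) by (simp add: qs)
    ultimately have "Mat2 p q' r s' \<in> Gamma1T"
      using at0 by (simp add: Gamma1T_iff)
    moreover have "mmul (hecke_mat P i) \<gamma> = mmul (Mat2 p q' r s') (hecke_mat P (Some \<beta>))"
      unfolding M by (simp add: qs del: mult_pCons_left)
    ultimately show ?thesis
      by blast
  qed
qed

text \<open>At the root of \<open>P\<close> the rows span the line of \<open>(0, 1)\<close> for
  \<open>None\<close> and of \<open>(1, b)\<close> for \<open>Some b\<close>, and left
  multiplication cannot leave the row space.\<close>

lemma hecke_mat_inj:
  fixes P :: "'f::field poly"
  assumes P: "degree P = 1" and eq: "hecke_mat P i = mmul \<delta> (hecke_mat P j)"
  shows "i = j"
proof -
  obtain t where t: "\<And>p. P dvd p \<longleftrightarrow> poly p t = 0"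
    using linear_root[OF P] by metis
  have Pt: "poly P t = 0"
    using t[of P] by simp
  have P0: "P \<noteq> 0"
    using P by auto
  obtain p q r s where \<delta>: "\<delta> = Mat2 p q r s"
    by (cases \<delta>)
  show ?thesis
  proof (cases i; cases j)
    fix b assume "i = None" "j = Some b"
    then have "1 = s * P"
      using eq by (auto simp: \<delta>)
    from arg_cong[OF this, of "\<lambda>p. poly p t"] show ?thesis
      using Pt by simp
  next
    fix b assume "i = Some b" "j = None"
    then have "1 = p * P"
      using eq by (simp add: \<delta>) metis
    from arg_cong[OF this, of "\<lambda>p. poly p t"] show ?thesis
      using Pt by simp
  next
    fix b b' assume ij: "i = Some b" "j = Some b'"
    then have "p = 1" "[:b:] * (1 - P) = p * ([:b':] * (1 - P)) + q * P"
      using eq by (simp_all add: \<delta> del: mult_pCons_left)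
    then have "poly ([:b:] * (1 - P)) t = poly ([:b':] * (1 - P) + q * P) t"
      by simp
    then show ?thesis
      using ij Pt by simp
  qed simp
qed

section \<open>Hecke operators preserve harmonic cocycles\<close>

context laurent_embedding
begin

lemma mK_hecke_mat_GL2K: "P \<noteq> 0 \<Longrightarrow> mK (hecke_mat P i) \<in> GL2K"
  by (simp add: GL2K_def mdet_mmap_Kinf)

text \<open>Left multiplication respects edges, so the chosen representative may be replaced by
  \<open>h\<close>. Polynomials of degree below 1 are the constants, which makes the index set
  \<open>'f option\<close>.\<close>

lemma hecke_edge_of:
  assumes P: "degree P = 1" and h: "h \<in> GL2K"
  shows "hecke \<iota> k m P c (edge_of h) = (\<lambda>l. \<iota> (Kinf_of_poly P) powi (int k - m - 1) *
    (\<Sum>i\<in>UNIV. act \<iota> k m (minv (mK (hecke_mat P i))) (c (edge_of (mmul (mK (hecke_mat P i)) h))) l))"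
proof -
  have P0: "P \<noteq> 0"
    using P by auto
  define h' where "h' = (SOME h'. h' \<in> edge_of h)"
  have "h' \<in> edge_of h"
    unfolding h'_def using edge_of_self[OF h] by (rule someI)
  then have h': "edge_of h' = edge_of h"
    using edge_of_mem(2)[OF h] by blast
  have cong: "edge_of (mmul (mK (hecke_mat P i)) h') = edge_of (mmul (mK (hecke_mat P i)) h)" for i
    by (rule edge_of_mmul_cong[OF mK_hecke_mat_GL2K[OF P0] h'])
  have set: "{b. degree b < degree P} = range (\<lambda>b. [:b:])"
    unfolding P by (auto elim: degree_eq_zeroE)
  have inj: "inj (\<lambda>b::'f. [:b:])"
    by (auto intro: injI)
  have "edge_of h \<in> Edges"
    using h by (simp add: Edges_def)
  then show ?thesis
    unfolding hecke_def hecke_rep_def Let_def h'_def[symmetric] set sum.reindex[OF inj]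
    by (simp add: UNIV_option_conv sum.reindex flip: cong)
qed

text \<open>The relation \<open>g_i \<gamma> = \<delta>_i g_(\<sigma> i)\<close> moves
  \<open>\<gamma>\<close> to the left of each term and permutes the representatives:
  \<open>\<sigma>\<close> is injective on a finite set, since the cosets are distinct.\<close>

lemma hecke_equivariant:
  assumes P: "degree P = 1" "poly P 0 = 1" and c: "c \<in> H k m" and \<gamma>: "\<gamma> \<in> Gamma1T" and h: "h \<in> GL2K"
  shows "hecke \<iota> k m P c (edge_of (mmul (mK \<gamma>) h)) = act \<iota> k m (mK \<gamma>) (hecke \<iota> k m P c (edge_of h))"
proof -
  let ?g = "\<lambda>i. mK (hecke_mat P i)"
  let ?C = "\<iota> (Kinf_of_poly P) powi (int k - m - 1)"
  have P0: "P \<noteq> 0"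
    using P by auto
  have G: "?g i \<in> GL2K" for i
    by (rule mK_hecke_mat_GL2K[OF P0])
  then have det: "mdet (?g i) \<noteq> 0" for i
    by (simp add: GL2K_def)
  obtain \<sigma> \<delta> where \<delta>: "\<And>i. \<delta> i \<in> Gamma1T"
    and \<sigma>: "\<And>i. mmul (hecke_mat P i) \<gamma> = mmul (\<delta> i) (hecke_mat P (\<sigma> i))"
    using hecke_mat_permute[OF P \<gamma>] by metis
  have "inj \<sigma>"
  proof (rule injI)
    fix i i' assume eq: "\<sigma> i = \<sigma> i'"
    obtain \<epsilon> where \<epsilon>: "mmul \<epsilon> (\<delta> i') = mone"
      using Gamma1T_inverse[OF \<delta>] by metis
    obtain \<gamma>' where \<gamma>': "mmul \<gamma> \<gamma>' = mone"
      using Gamma1T_inverse[OF \<gamma>] by metis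
    have "hecke_mat P (\<sigma> i) = mmul \<epsilon> (mmul (hecke_mat P i') \<gamma>)"
      unfolding \<sigma> eq by (simp add: \<epsilon> flip: mmul_assoc)
    then have "mmul (hecke_mat P i) \<gamma> = mmul (\<delta> i) (mmul \<epsilon> (mmul (hecke_mat P i') \<gamma>))"
      unfolding \<sigma>[of i] by simp
    then have "mmul (mmul (hecke_mat P i) \<gamma>) \<gamma>' = mmul (mmul (\<delta> i) (mmul \<epsilon> (mmul (hecke_mat P i') \<gamma>))) \<gamma>'"
      by simp
    then have "hecke_mat P i = mmul (mmul (\<delta> i) \<epsilon>) (hecke_mat P i')"
      by (simp only: mmul_assoc \<gamma>' mmul_mone)
    then show "i = i'"
      by (rule hecke_mat_inj[OF P(1)])
  qed
  then have bij: "bij \<sigma>"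
    by (simp add: bij_def finite_UNIV_inj_surj)
  have "act \<iota> k m (minv (?g i)) (c (edge_of (mmul (?g i) (mmul (mK \<gamma>) h))))
    = act \<iota> k m (mK \<gamma>) (act \<iota> k m (minv (?g (\<sigma> i))) (c (edge_of (mmul (?g (\<sigma> i)) h))))" for i
  proof -
    have eq: "mmul (?g i) (mK \<gamma>) = mmul (mK (\<delta> i)) (?g (\<sigma> i))"
      by (simp add: \<sigma> flip: mmap_Kinf_mmul)
    have "mmul (?g i) (mmul (mK \<gamma>) h) = mmul (mK (\<delta> i)) (mmul (?g (\<sigma> i)) h)"
      by (simp only: eq flip: mmul_assoc)
    then have "c (edge_of (mmul (?g i) (mmul (mK \<gamma>) h)))
        = act \<iota> k m (mK (\<delta> i)) (c (edge_of (mmul (?g (\<sigma> i)) h)))"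
      using cocycle_equivariant[OF c \<delta> GL2K_mmul[OF G h]] by (simp only:)
    moreover have "mmul (minv (?g i)) (mK (\<delta> i)) = mmul (mK \<gamma>) (minv (?g (\<sigma> i)))"
    proof -
      have "mmul (minv (?g i)) (mK (\<delta> i)) = mmul (minv (?g i)) (mmul (mmul (mK (\<delta> i)) (?g (\<sigma> i))) (minv (?g (\<sigma> i))))"
        by (simp only: mmul_assoc minv_right[OF det] mmul_mone)
      also have "\<dots> = mmul (mK \<gamma>) (minv (?g (\<sigma> i)))"
        by (simp only: eq[symmetric] mmul_assoc minv_cancel[OF det])
      finally show ?thesis .
    qed
    ultimately show ?thesis
      by (simp only: flip: act_mmul)
  qed
  then have "hecke \<iota> k m P c (edge_of (mmul (mK \<gamma>) h)) = (\<lambda>l. ?C *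
    (\<Sum>i\<in>UNIV. act \<iota> k m (mK \<gamma>) (act \<iota> k m (minv (?g (\<sigma> i))) (c (edge_of (mmul (?g (\<sigma> i)) h)))) l))"
    using \<gamma> h by (simp only: hecke_edge_of[OF P(1)] GL2K_mmul mK_GL2K)
  also have "\<dots> = (\<lambda>l. ?C *
    (\<Sum>i\<in>UNIV. act \<iota> k m (mK \<gamma>) (act \<iota> k m (minv (?g i)) (c (edge_of (mmul (?g i) h)))) l))"
    by (simp only: sum.reindex_bij_betw[OF bij,
          of "\<lambda>i. act \<iota> k m (mK \<gamma>) (act \<iota> k m (minv (?g i)) (c (edge_of (mmul (?g i) h)))) _"])
  also have "\<dots> = act \<iota> k m (mK \<gamma>) (hecke \<iota> k m P c (edge_of h))"
    by (simp only: hecke_edge_of[OF P(1) h] sum_distrib_left act_sum)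
  finally show ?thesis .
qed

lemma hecke_harmonic:
  assumes P: "degree P = 1" "poly P 0 = 1" and c: "c \<in> H k m"
  shows "hecke \<iota> k m P c \<in> H k m"
proof -
  let ?T = "hecke \<iota> k m P c"
  let ?g = "\<lambda>i. mK (hecke_mat P i)"
  let ?C = "\<iota> (Kinf_of_poly P) powi (int k - m - 1)"
  note T = hecke_edge_of[OF P(1), of _ k m c]
  have P0: "P \<noteq> 0"
    using P by auto
  have G: "?g i \<in> GL2K" for i
    by (rule mK_hecke_mat_GL2K[OF P0])
  have outside: "?T E = (\<lambda>_. 0)" if "E \<notin> Edges" for E
    using that by (simp add: hecke_def)
  have "?T E \<in> homV k" for E
  proof (cases "E \<in> Edges")
    case True
    then obtain h where h: "h \<in> GL2K" "E = edge_of h"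
      by (auto simp: Edges_def)
    show ?thesis
      unfolding h(2) T[OF h(1)] using act_homV by (auto simp: homV_def intro!: sum.neutral)
  qed (simp add: outside homV_def)
  moreover have "(\<Sum>E\<in>edges_into v. ?T E l) = 0" if v: "v \<in> Vertices" for v l
  proof -
    obtain h where h: "h \<in> GL2K" "v = vertex_of h"
      using v by (auto simp: Vertices_def)
    define \<psi> where "\<psi> = (\<lambda>i E. act \<iota> k m (minv (?g i)) (c E) l)"
    have R: "reverse_rep h \<in> GL2K" "reverse_rep (mmul h (nbr \<beta>)) \<in> GL2K" for \<beta>
      using h by auto
    have "(\<Sum>E\<in>edges_into v. ?T E l)
      = ?C * ((\<Sum>i\<in>UNIV. \<psi> i (edge_of (mmul (?g i) (reverse_rep h))))
        + (\<Sum>\<beta>\<in>UNIV. \<Sum>i\<in>UNIV. \<psi> i (edge_of (mmul (?g i) (reverse_rep (mmul h (nbr \<beta>)))))))"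
      unfolding h(2) sum_edges_into[OF h(1)] T[OF R(1)] T[OF R(2)] \<psi>_def
      by (simp only: distrib_left sum_distrib_left)
    \<comment> \<open>Each representative carries the star of \<open>h\<close> onto the star of its
      image; exchanging the sums leaves one vertex condition of \<open>c\<close> for each
      \<open>i\<close>.\<close>
    also have "\<dots> = ?C * (\<Sum>i\<in>UNIV. \<Sum>E\<in>edges_into (vertex_of (mmul (?g i) h)). \<psi> i E)"
    proof -
      have "(\<Sum>E\<in>edges_into (vertex_of (mmul (?g i) h)). \<psi> i E)
        = \<psi> i (edge_of (mmul (?g i) (reverse_rep h)))
          + (\<Sum>\<beta>\<in>UNIV. \<psi> i (edge_of (mmul (?g i) (reverse_rep (mmul h (nbr \<beta>))))))" for i
        using sum_edges_into[OF GL2K_mmul[OF G h(1)], of "\<psi> i"] by (simp add: mmul_assoc reverse_rep_mmul)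
      then show ?thesis
        by (simp only: sum.distrib sum.swap[of _ "UNIV :: 'f set"])
    qed
    also have "\<dots> = 0"
    proof -
      have "(\<Sum>E\<in>edges_into (vertex_of (mmul (?g i) h)). \<psi> i E) = 0" for i
      proof -
        have "vertex_of (mmul (?g i) h) \<in> Vertices"
          using G h(1) by (auto simp: Vertices_def)
        then have "(\<lambda>l. \<Sum>E\<in>edges_into (vertex_of (mmul (?g i) h)). 1 * c E l) = (\<lambda>_. 0)"
          using c by (simp add: harmonic_cocycles_def)
        then show ?thesis
          using fun_cong[OF act_sum[of k m "minv (?g i)" "\<lambda>_. 1" c], of "edges_into (vertex_of (mmul (?g i) h))" l]
          by (simp add: \<psi>_def act_zero)
      qed
      then show ?thesis
        by simp
    qed
    finally show ?thesis .
  qed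
  moreover have "?T (edge_of (reverse_rep g)) l = - ?T (edge_of g) l" if "g \<in> GL2K" for g l
  proof -
    have "c (edge_of (mmul (?g i) (reverse_rep g))) = (\<lambda>l. - c (edge_of (mmul (?g i) g)) l)" for i
      using cocycle_reverse[OF c GL2K_mmul[OF G that]] by (simp add: reverse_rep_mmul)
    then show ?thesis
      by (simp add: T[OF that] T[OF reverse_rep_GL2K[OF that]] act_minus sum_negf)
  qed
  moreover note hecke_equivariant[OF P c] outside
  ultimately show ?thesis
    unfolding harmonic_cocycles_def mem_Collect_eq by blast
qed

section \<open>The value of the Hecke operator at \<open>gamma0\<close>\<close>

lemma hom_const_inverse: "\<iota> (fls_const (inverse b)) = inverse (\<iota> (fls_const b))"
  by (simp add: hom_inverse fls_const_inverse)

lemma sum_power_nonzero: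
  assumes "0 < e" "e < card (UNIV :: 'f set) - 1"
  shows "(\<Sum>b\<in>-{0}. \<iota> (fls_const b) ^ e) = 0"
proof -
  have "(\<Sum>b\<in>UNIV. \<iota> (fls_const b) ^ e) = (\<Sum>b\<in>-{0}. \<iota> (fls_const b) ^ e)"
    using assms by (intro sum.mono_neutral_right) (auto simp: hom_zero)
  then show ?thesis
    using sum_const_power[OF assms(2)] by simp
qed

text \<open>The diagonal case counts the nonzero elements, \<open>q - 1 = -1\<close>. Otherwise, up
  to inverting \<open>b\<close>, it is a power sum of exponent strictly between 0 and
  \<open>q - 1\<close>.\<close>

lemma sum_power_mult_inverse_power:
  assumes "l < card (UNIV :: 'f set) - 1" "i < card (UNIV :: 'f set) - 1"
  shows "(\<Sum>b\<in>-{0}. \<iota> (fls_const b) ^ l * inverse (\<iota> (fls_const b)) ^ i) = (if l = i then - 1 else 0)"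
proof -
  have nz: "\<iota> (fls_const b) \<noteq> 0" if "b \<noteq> 0" for b
    using that by (simp add: hom_eq_0_iff)
  consider "l = i" | "i < l" | "l < i"
    by linarith
  then show ?thesis
  proof cases
    case 1
    have "(\<Sum>b\<in>-{0}. \<iota> (fls_const b) ^ l * inverse (\<iota> (fls_const b)) ^ i) = (\<Sum>b\<in>-{0::'f}. 1)"
      using nz 1 by (intro sum.cong) (auto simp flip: power_mult_distrib)
    also have "\<dots> = (\<Sum>b\<in>(UNIV :: 'f set). 1) - 1"
      using sum.remove[of "UNIV :: 'f set" 0 "\<lambda>_. 1 :: 'c"] by (simp add: Compl_eq_Diff_UNIV)
    also have "(\<Sum>b\<in>(UNIV :: 'f set). 1 :: 'c) = \<iota> (of_nat (card (UNIV :: 'f set)))"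
      by (simp add: hom_of_nat)
    also have "of_nat (card (UNIV :: 'f set)) = (0 :: 'f fls)"
      by (simp add: fls_of_nat of_nat_card_field)
    finally show ?thesis
      using 1 by (simp add: hom_zero)
  next
    case 2
    have "(\<Sum>b\<in>-{0}. \<iota> (fls_const b) ^ l * inverse (\<iota> (fls_const b)) ^ i)
        = (\<Sum>b\<in>-{0}. \<iota> (fls_const b) ^ (l - i))"
      using nz 2 by (intro sum.cong) (auto simp: power_diff power_inverse divide_inverse)
    then show ?thesis
      using 2 assms sum_power_nonzero[of "l - i"] by simp
  next
    case 3
    have "(\<Sum>b\<in>-{0}. \<iota> (fls_const b) ^ l * inverse (\<iota> (fls_const b)) ^ i)
        = (\<Sum>b\<in>-{0}. \<iota> (fls_const (inverse b)) ^ (i - l))"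
      using nz 3 by (intro sum.cong) (auto simp: hom_const_inverse power_diff power_inverse divide_inverse)
    also have "\<dots> = (\<Sum>b\<in>-{0}. \<iota> (fls_const b) ^ (i - l))"
      by (rule sum.reindex_bij_witness[of _ inverse inverse]) auto
    finally show ?thesis
      using 3 assms sum_power_nonzero[of "i - l"] by simp
  qed
qed

lemma linear_power_expand:
  "[:a, b:] ^ n = (\<Sum>l\<le>n. smult (of_nat (n choose l) * a ^ l * b ^ (n - l)) ([:0, 1:] ^ (n - l)))"
  for a b :: 'c
proof -
  have "[:a, b:] ^ n = ([:a:] + smult b [:0, 1:]) ^ n"
    by simp
  also have "\<dots> = (\<Sum>l\<le>n. of_nat (n choose l) * [:a:] ^ l * smult b [:0, 1:] ^ (n - l))"
    by (rule binomial_ring)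
  also have "\<dots> = (\<Sum>l\<le>n. smult (of_nat (n choose l) * a ^ l * b ^ (n - l)) ([:0, 1:] ^ (n - l)))"
    by (intro sum.cong refl) (simp only: of_nat_poly poly_const_pow smult_power mult_smult_left
        mult_smult_right mult_pCons_left smult_smult mult_zero_left pCons_0_0 add_0_right mult_ac)
  finally show ?thesis .
qed

lemma linear_power_expand':
  "[:a, b:] ^ n = (\<Sum>i\<le>n. smult (of_nat (n choose i) * b ^ i * a ^ (n - i)) ([:0, 1:] ^ i))"
  for a b :: 'c
  unfolding linear_power_expand[of a b n]
  by (rule sum.reindex_bij_witness[of _ "\<lambda>i. n - i" "\<lambda>i. n - i"]) (auto simp: mult_ac simp flip: binomial_symmetric)

text \<open>Expanding, the monomial \<open>x^(j - l + i)\<close> carries \<open>b^(l - i)\<close>.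
  Summation over \<open>b\<close> leaves only \<open>l = i\<close>, so all surviving terms are
  multiples of \<open>x^j\<close>: this is why the Hecke operator is diagonal.\<close>

lemma sum_forms:
  assumes "j + r < card (UNIV :: 'f set) - 1"
  shows "(\<Sum>b\<in>-{0}. [:- \<iota> (fls_const b), 1:] ^ j * [:1, - (z * inverse (\<iota> (fls_const b))):] ^ r)
    = smult (- (\<Sum>l\<le>j. of_nat ((j choose l) * (r choose l)) * z ^ l)) ([:0, 1:] ^ j)"
proof -
  let ?\<kappa> = "\<lambda>b. \<iota> (fls_const b)"
  define B where "B = (\<lambda>l i. of_nat (j choose l) * of_nat (r choose i) * (- 1) ^ (l + i) * z ^ i :: 'c)"
  have "[:- ?\<kappa> b, 1:] ^ j * [:1, - (z * inverse (?\<kappa> b)):] ^ r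
    = (\<Sum>l\<le>j. \<Sum>i\<le>r. smult (B l i * (?\<kappa> b ^ l * inverse (?\<kappa> b) ^ i)) ([:0, 1:] ^ (j - l + i)))" for b
  proof -
    have "[:- ?\<kappa> b, 1:] ^ j * [:1, - (z * inverse (?\<kappa> b)):] ^ r
      = (\<Sum>l\<le>j. smult (of_nat (j choose l) * (- ?\<kappa> b) ^ l * 1 ^ (j - l)) ([:0, 1:] ^ (j - l)))
        * (\<Sum>i\<le>r. smult (of_nat (r choose i) * (- (z * inverse (?\<kappa> b))) ^ i * 1 ^ (r - i)) ([:0, 1:] ^ i))"
      by (rule arg_cong2[where f = "(*)", OF linear_power_expand linear_power_expand'])
    also have "\<dots> = (\<Sum>l\<le>j. \<Sum>i\<le>r. smult (B l i * (?\<kappa> b ^ l * inverse (?\<kappa> b) ^ i)) ([:0, 1:] ^ (j - l + i)))"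
      unfolding sum_product
    proof (intro sum.cong refl)
      fix l i
      have "of_nat (j choose l) * (- ?\<kappa> b) ^ l * 1 ^ (j - l)
            * (of_nat (r choose i) * (- (z * inverse (?\<kappa> b))) ^ i * 1 ^ (r - i))
          = B l i * (?\<kappa> b ^ l * inverse (?\<kappa> b) ^ i)"
        by (simp only: B_def power_minus[of "?\<kappa> b"] power_minus[of "z * inverse (?\<kappa> b)"]
            power_mult_distrib power_add power_one mult_1_left mult_1_right mult_ac)
      then show "smult (of_nat (j choose l) * (- ?\<kappa> b) ^ l * 1 ^ (j - l)) ([:0, 1:] ^ (j - l))
          * smult (of_nat (r choose i) * (- (z * inverse (?\<kappa> b))) ^ i * 1 ^ (r - i)) ([:0, 1:] ^ i)
        = smult (B l i * (?\<kappa> b ^ l * inverse (?\<kappa> b) ^ i)) ([:0, 1:] ^ (j - l + i))"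
        by (simp only: mult_smult_left mult_smult_right smult_smult power_add mult.commute[of "of_nat (r choose i) * _ * _"])
    qed
    finally show ?thesis .
  qed
  then have "(\<Sum>b\<in>-{0}. [:- ?\<kappa> b, 1:] ^ j * [:1, - (z * inverse (?\<kappa> b)):] ^ r)
    = (\<Sum>b\<in>-{0}. \<Sum>l\<le>j. \<Sum>i\<le>r. smult (B l i * (?\<kappa> b ^ l * inverse (?\<kappa> b) ^ i)) ([:0, 1:] ^ (j - l + i)))"
    by simp
  also have "\<dots> = (\<Sum>l\<le>j. \<Sum>i\<le>r. \<Sum>b\<in>-{0}. smult (B l i * (?\<kappa> b ^ l * inverse (?\<kappa> b) ^ i)) ([:0, 1:] ^ (j - l + i)))"
    by (subst sum.swap) (intro sum.cong refl, rule sum.swap)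
  also have "\<dots> = (\<Sum>l\<le>j. \<Sum>i\<le>r. smult (B l i * (if l = i then - 1 else 0)) ([:0, 1:] ^ (j - l + i)))"
  proof (intro sum.cong refl)
    fix l i assume "l \<in> {..j}" "i \<in> {..r}"
    then have "(\<Sum>b\<in>-{0}. ?\<kappa> b ^ l * inverse (?\<kappa> b) ^ i) = (if l = i then - 1 else 0)"
      using assms by (intro sum_power_mult_inverse_power) auto
    then show "(\<Sum>b\<in>-{0}. smult (B l i * (?\<kappa> b ^ l * inverse (?\<kappa> b) ^ i)) ([:0, 1:] ^ (j - l + i)))
      = smult (B l i * (if l = i then - 1 else 0)) ([:0, 1:] ^ (j - l + i))"
      by (simp only: flip: sum_distrib_left smult_sum)
  qed
  also have "\<dots> = (\<Sum>l\<le>j. smult (- (of_nat ((j choose l) * (r choose l)) * z ^ l)) ([:0, 1:] ^ j))"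
  proof (intro sum.cong refl)
    fix l assume l: "l \<in> {..j}"
    have "(\<Sum>i\<le>r. smult (B l i * (if l = i then - 1 else 0)) ([:0, 1:] ^ (j - l + i)))
      = (\<Sum>i\<le>r. if l = i then smult (- B l l) ([:0, 1:] ^ j) else 0)"
      using l by (intro sum.cong) auto
    \<comment> \<open>For \<open>l > r\<close> the sum over \<open>i\<close> is empty of diagonal
      terms, in agreement with \<open>B l l = 0\<close>.\<close>
    also have "\<dots> = smult (- B l l) ([:0, 1:] ^ j)"
      by (cases "l \<le> r") (simp_all add: B_def binomial_eq_0)
    also have "B l l = of_nat ((j choose l) * (r choose l)) * z ^ l"
      by (simp add: B_def flip: mult_2)
    finally show "(\<Sum>i\<le>r. smult (B l i * (if l = i then - 1 else 0)) ([:0, 1:] ^ (j - l + i)))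
      = smult (- (of_nat ((j choose l) * (r choose l)) * z ^ l)) ([:0, 1:] ^ j)" .
  qed
  finally show ?thesis
    by (simp only: sum_negf flip: smult_sum)
qed

text \<open>\<open>P\<close> has valuation \<open>-1\<close>, so \<open>gamma0\<close> moves to
  level \<open>-1\<close>, and the reversal of that edge is the edge of \<open>mone\<close>, outside
  the orbit.\<close>

lemma cocycle_of_hecke_None:
  assumes P: "degree P = 1"
  shows "cocycle_of k m w (edge_of (mmul (mK (hecke_mat P None)) w0)) = (\<lambda>_. 0)"
proof -
  have P0: "P \<noteq> 0"
    using P by auto
  have "edge_of (Mat2 0 (Kinf_of_poly P) 1 0) = edge_of (edge_rep (0 - 1) 0)"
    using edge_of_low[of 1 0 0 "Kinf_of_poly P"] P0 by (simp add: subdegree_Kinf P)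
  moreover have "reverse_rep (edge_rep (0 - 1) 0) = (mone :: 'f fls mat2)"
    unfolding reverse_edge_rep by simp
  then have "cocycle_of k m w (edge_of (edge_rep (0 - 1) 0)) = (\<lambda>_. 0)"
    using cocycle_of_reverse[of "edge_rep (0 - 1) 0" k m w] cocycle_of_mone[of k m w] by (simp add: fun_eq_iff)
  ultimately show ?thesis
    by simp
qed

text \<open>Here \<open>gamma0\<close> moves to level 1 at the point 0, again an edge of value
  0.\<close>

lemma cocycle_of_hecke_Some_0:
  assumes P: "degree P = 1"
  shows "cocycle_of k m w (edge_of (mmul (mK (hecke_mat P (Some 0))) w0)) = (\<lambda>_. 0)"
proof -
  have P0: "P \<noteq> 0"
    using P by auto
  have "edge_of (Mat2 0 1 (Kinf_of_poly P) 0) = edge_of (edge_rep 1 0)"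
    using edge_of_low[of "Kinf_of_poly P" 0 0 1] P0 by (simp add: subdegree_Kinf P)
  then show ?thesis
    by (simp add: cocycle_of_one)
qed

text \<open>Left multiplication by \<open>\<delta>\<close> turns the representative into
  \<open>N\<close>, with rows \<open>(1, b)\<close> and \<open>(s, 1)\<close>, and \<open>N\<close>
  sends \<open>gamma0\<close> to an edge whose reversal is \<open>gamma0\<close>. The value there is
  \<open>- w\<close>, and undoing \<open>\<delta>\<close> combines with the inverse of the
  representative to the inverse of \<open>N\<close>.\<close>

lemma cocycle_of_hecke_Some:
  assumes P: "degree P = 1" "poly P 0 = 1" and b: "b \<noteq> 0" and w: "w \<in> homV k"
  defines "s \<equiv> (1 - Kinf_of_poly P) / fls_const b"
  shows "act \<iota> k m (minv (mK (hecke_mat P (Some b)))) (cocycle_of k m w (edge_of (mmul (mK (hecke_mat P (Some b))) w0)))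
    = (\<lambda>l. - act \<iota> k m (minv (Mat2 1 (fls_const b) s 1)) w l)"
proof -
  let ?g = "mK (hecke_mat P (Some b))"
  define S where "S = [:inverse b:] * (1 - P)"
  \<comment> \<open>The upper factor replaces \<open>b (1 - P)\<close> by \<open>b\<close>. The
    lower one turns the corner \<open>P\<close> into \<open>S b + P = 1\<close>, which determines
    \<open>S\<close>.\<close>
  define \<delta> where "\<delta> = mmul (Mat2 1 0 S 1) (Mat2 1 [:b:] 0 1)"
  define N where "N = Mat2 1 [:b:] S 1"
  have P0: "P \<noteq> 0"
    using P by auto
  have KS: "Kinf_of_poly S = s"
    by (simp add: S_def s_def Kinf_smult Kinf_diff fls_const_inverse divide_inverse mult.commute)
  have bS: "[:b:] * S = 1 - P"
  proof -
    have "[:b:] * S = ([:b:] * [:inverse b:]) * (1 - P)"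
      by (simp only: S_def mult.assoc)
    also have "[:b:] * [:inverse b:] = 1"
      using b by (simp add: one_pCons)
    finally show ?thesis
      by simp
  qed
  have \<delta>: "\<delta> \<in> Gamma1T"
    unfolding \<delta>_def using P(2) by (intro Gamma1T_mmul) (simp_all add: Gamma1T_iff S_def)
  have U: "mmul (Mat2 1 [:b:] 0 1) (hecke_mat P (Some b)) = Mat2 1 [:b:] 0 P"
    by (simp add: smult_diff_right)
  have \<delta>g: "mmul \<delta> (hecke_mat P (Some b)) = N"
    unfolding \<delta>_def mmul_assoc U using bS
    by (simp add: N_def mult.commute del: mult_pCons_left mult_pCons_right)
  define M where "M = mmul (mK N) w0"
  have M: "M = Mat2 (fls_const b) 1 1 s"
    by (simp add: M_def N_def KS Kinf_const)
  have s0: "fls_const b * s = 1 - Kinf_of_poly P"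
    using b by (simp add: s_def)
  have deg: "1 - P \<noteq> 0" "degree (1 - P) = 1"
  proof -
    have "coeff P 1 \<noteq> 0"
      using P(1) P0 leading_coeff_neq_0[of P] by simp
    then have "coeff (1 - P) 1 \<noteq> 0"
      by simp
    moreover have "degree (1 - P) \<le> 1"
      using P(1) by (intro degree_diff_le) simp_all
    ultimately show "1 - P \<noteq> 0" "degree (1 - P) = 1"
      using le_degree[of "1 - P" 1] by auto
  qed
  have s: "s \<noteq> 0" "fls_subdegree s = - 1"
  proof -
    have "1 - Kinf_of_poly P = Kinf_of_poly (1 - P)"
      by (simp add: Kinf_diff)
    then have "1 - Kinf_of_poly P \<noteq> 0" "fls_subdegree (1 - Kinf_of_poly P) = - 1"
      using deg subdegree_Kinf[OF deg(1)] by simp_all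
    then show "s \<noteq> 0" "fls_subdegree s = - 1"
      using b by (simp_all add: s_def subdegree_divide)
  qed
  \<comment> \<open>The determinant and \<open>s\<close> both have valuation \<open>-1\<close>,
    giving level \<open>-1 + 2 - 1 = 0\<close>; moreover \<open>1 / s\<close> lies in the maximal
    ideal and may be replaced by 0.\<close>
  have "edge_of (reverse_rep M) = edge_of (edge_rep 0 (1 / s))"
    using edge_of_high[of s 1 "fls_const b" 1] s P0 by (simp add: M s0 subdegree_Kinf P(1))
  also have "\<dots> = edge_of (edge_rep 0 0)"
    using s by (intro edge_of_edge_rep_cong) (simp add: vge_divide)
  finally have "edge_of (reverse_rep M) = edge_of w0"
    by (simp add: edge_rep_def)
  moreover have MG: "M \<in> GL2K"
    using P0 by (simp add: M GL2K_def s0)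
  ultimately have cM: "cocycle_of k m w (edge_of M) = (\<lambda>l. - w l)"
    using cocycle_of_reverse[OF MG, of k m w] cocycle_of_gamma0[OF w, of m]
    by (simp add: gamma0_def fun_eq_iff minus_equation_iff)
  note G1 = mK_hecke_mat_GL2K[OF P0, of "Some b"]
  note G = G1 GL2K_mmul[OF G1 w0_GL2K]
  have "mmul (mK \<delta>) (mmul ?g w0) = M"
    by (simp only: M_def \<delta>g[symmetric] mmap_Kinf_mmul mmul_assoc)
  then have "act \<iota> k m (mK \<delta>) (cocycle_of k m w (edge_of (mmul ?g w0))) = (\<lambda>l. - w l)"
    using cocycle_of_equivariant[OF \<delta> G(2), of k m w] cM by simp
  then have "act \<iota> k m (minv (mK N)) (act \<iota> k m (mK \<delta>) (cocycle_of k m w (edge_of (mmul ?g w0))))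
      = (\<lambda>l. - act \<iota> k m (minv (mK N)) w l)"
    by (simp add: act_minus)
  moreover have "mmul (minv (mK N)) (mK \<delta>) = minv ?g"
  proof -
    have det: "mdet (mK \<delta>) \<noteq> 0" "mdet ?g \<noteq> 0"
      using mK_det[OF \<delta>] G(1) unfolding GL2K_def by auto
    have "minv (mK N) = mmul (minv ?g) (minv (mK \<delta>))"
      using minv_mmul[OF det] by (simp only: \<delta>g flip: mmap_Kinf_mmul)
    then show ?thesis
      by (simp only: mmul_assoc minv_left[OF det(1)] mmul_mone)
  qed
  ultimately show ?thesis
    by (simp add: N_def KS Kinf_const flip: act_mmul)
qed

text \<open>The inverse matrix is \<open>1/p\<close> times the adjugate. The determinant factor
  contributes the exponent \<open>-(1 - m)\<close> and the form of degree \<open>k - 2\<close> the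
  exponent \<open>-(k - 2)\<close>, exactly cancelling the Hecke normalization.\<close>

lemma act_minv_form:
  assumes k: "2 \<le> k" and j: "j \<le> k - 2" and b: "b \<noteq> 0" and p: "p \<noteq> 0"
    and s: "s = (1 - p) / fls_const b"
  shows "\<iota> p powi (int k - m - 1) * act \<iota> k m (minv (Mat2 1 (fls_const b) s 1)) w j
    = pairing (k - 2) w ([:- \<iota> (fls_const b), 1:] ^ j
        * [:1, - (\<iota> (1 - p) * inverse (\<iota> (fls_const b))):] ^ (k - 2 - j))"
proof -
  let ?p = "\<iota> p"
  have p0: "?p \<noteq> 0"
    using p by (simp add: hom_eq_0_iff)
  have bs: "1 * 1 - fls_const b * s = p"
    using b by (simp add: s)
  have m: "minv (Mat2 1 (fls_const b) s 1) = Mat2 (1 / p) (- fls_const b / p) (- s / p) (1 / p)"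
    by (simp only: minv.simps Let_def bs)
  have "mdet (Mat2 1 (fls_const b) s 1) = p"
    using bs by simp
  then have "mdet (minv (Mat2 1 (fls_const b) s 1)) = inverse p"
    using mdet_minv p by metis
  then have det: "1 / p * (1 / p) - - fls_const b / p * (- s / p) = inverse p"
    unfolding m by simp
  have f: "[:\<iota> (- fls_const b / p), \<iota> (1 / p):] = smult (inverse ?p) [:- \<iota> (fls_const b), 1:]"
    "[:\<iota> (1 / p), \<iota> (- s / p):] = smult (inverse ?p) [:1, - (\<iota> (1 - p) * inverse (\<iota> (fls_const b))):]"
    by (simp_all add: s hom_mult hom_inverse hom_minus hom_one divide_inverse mult_ac)
  have "[:\<iota> (- fls_const b / p), \<iota> (1 / p):] ^ j * [:\<iota> (1 / p), \<iota> (- s / p):] ^ (k - 2 - j)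
    = smult (inverse ?p ^ (k - 2)) ([:- \<iota> (fls_const b), 1:] ^ j
        * [:1, - (\<iota> (1 - p) * inverse (\<iota> (fls_const b))):] ^ (k - 2 - j))"
    unfolding f by (simp only: smult_power mult_smult_left mult_smult_right smult_smult
      power_add[symmetric] le_add_diff_inverse[OF j] le_add_diff_inverse2[OF j])
  moreover have "pairing (k - 2) w (smult e q) = e * pairing (k - 2) w q" for e q
    by (simp add: pairing_def sum_distrib_left mult.assoc)
  moreover have "?p powi (int k - m - 1) * (inverse ?p powi (1 - m) * inverse ?p ^ (k - 2)) = 1"
  proof -
    have "inverse ?p powi (1 - m) * inverse ?p ^ (k - 2) = ?p powi (- (1 - m) - int (k - 2))"
      using p0 by (simp add: power_int_inverse power_int_minus power_int_diff power_inverse divide_inverse)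
    moreover have "?p powi (int k - m - 1) * ?p powi (- (1 - m) - int (k - 2)) = ?p powi 0"
      using p0 k by (subst power_int_add[symmetric]) (simp_all add: of_nat_diff)
    ultimately show ?thesis
      by simp
  qed
  ultimately show ?thesis
    unfolding m act_eq_pairing det using j by (simp add: hom_inverse mult.assoc[symmetric] del: diff_diff_left)
qed

text \<open>Of the \<open>q + 1\<close> terms two vanish. In the others the minus sign from the
  reversal meets the one in \<open>sum_forms\<close>, and \<open>z = 1 - P\<close> produces
  \<open>lambdaj\<close>.\<close>

lemma hecke_cocycle_of_gamma0:
  assumes k: "2 \<le> k" "k \<le> card (UNIV :: 'f set)" and P: "degree P = 1" "poly P 0 = 1"
    and w: "w \<in> homV k" and j: "j \<le> k - 2"
  shows "hecke \<iota> k m P (cocycle_of k m w) gamma0 j = \<iota> (Kinf_of_poly (lambdaj k j P)) * w j"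
proof -
  let ?c = "cocycle_of k m w"
  let ?p = "Kinf_of_poly P"
  let ?C = "\<iota> ?p powi (int k - m - 1)"
  let ?z = "\<iota> (1 - ?p)"
  let ?t = "\<lambda>i. act \<iota> k m (minv (mK (hecke_mat P i))) (?c (edge_of (mmul (mK (hecke_mat P i)) w0))) j"
  let ?N = "\<lambda>b. Mat2 1 (fls_const b) ((1 - ?p) / fls_const b) 1"
  have P0: "P \<noteq> 0"
    using P by auto
  have "(\<Sum>i\<in>UNIV. ?t i) = ?t None + (\<Sum>b\<in>UNIV. ?t (Some b))"
    by (simp add: UNIV_option_conv sum.reindex del: hecke_mat.simps)
  also have "?t None = 0"
    by (simp only: cocycle_of_hecke_None[OF P(1)] act_zero)
  also have "(\<Sum>b\<in>UNIV. ?t (Some b)) = ?t (Some 0) + (\<Sum>b\<in>-{0}. ?t (Some b))"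
    by (subst sum.remove[of _ 0]) (simp_all add: Compl_eq_Diff_UNIV del: hecke_mat.simps)
  also have "?t (Some 0) = 0"
    by (simp only: cocycle_of_hecke_Some_0[OF P(1)] act_zero)
  also have "(\<Sum>b\<in>-{0}. ?t (Some b)) = (\<Sum>b\<in>-{0}. - act \<iota> k m (minv (?N b)) w j)"
  proof (intro sum.cong refl)
    fix b :: 'f assume "b \<in> - {0}"
    then have "b \<noteq> 0"
      by simp
    from fun_cong[OF cocycle_of_hecke_Some[OF P this w]]
    show "?t (Some b) = - act \<iota> k m (minv (?N b)) w j" .
  qed
  finally have t: "(\<Sum>i\<in>UNIV. ?t i) = - (\<Sum>b\<in>-{0}. act \<iota> k m (minv (?N b)) w j)"
    by (simp only: add_0_left sum_negf)
  have "hecke \<iota> k m P ?c gamma0 j = ?C * (\<Sum>i\<in>UNIV. ?t i)"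
    by (simp only: gamma0_def hecke_edge_of[OF P(1) w0_GL2K])
  also have "\<dots> = - (\<Sum>b\<in>-{0}. ?C * act \<iota> k m (minv (?N b)) w j)"
    by (simp only: t mult_minus_right sum_distrib_left)
  also have "(\<Sum>b\<in>-{0}. ?C * act \<iota> k m (minv (?N b)) w j)
    = (\<Sum>b\<in>-{0}. pairing (k - 2) w ([:- \<iota> (fls_const b), 1:] ^ j
        * [:1, - (?z * inverse (\<iota> (fls_const b))):] ^ (k - 2 - j)))"
    using P0 by (intro sum.cong refl act_minv_form[OF k(1) j]) simp_all
  also have "\<dots> = pairing (k - 2) w (smult (- (\<Sum>l\<le>j. of_nat ((j choose l) * ((k - 2 - j) choose l)) * ?z ^ l)) ([:0, 1:] ^ j))"
    unfolding sum_pairing using k j by (subst sum_forms) auto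
  also have "\<dots> = - (\<Sum>l\<le>j. of_nat ((j choose l) * ((k - 2 - j) choose l)) * ?z ^ l) * w j"
    using pairing_sum_smult[of "k - 2" w "\<lambda>_. - (\<Sum>l\<le>j. of_nat ((j choose l) * ((k - 2 - j) choose l)) * ?z ^ l)"
        "\<lambda>_. [:0, 1:] ^ j" "{()}"] pairing_X_power[OF j, of w]
    by (simp only: sum.insert sum.empty finite.emptyI empty_iff not_False_eq_True add_0_right)
  also have "(\<Sum>l\<le>j. of_nat ((j choose l) * ((k - 2 - j) choose l)) * ?z ^ l) = \<iota> (Kinf_of_poly (lambdaj k j P))"
    by (simp only: lambdaj_def Kinf_sum Kinf_mult Kinf_of_nat Kinf_power Kinf_diff Kinf_1
        hom_sum hom_mult hom_of_nat hom_power)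
  finally show ?thesis
    by simp
qed

section \<open>The basis \<open>cj\<close> and its eigenvalues\<close>

lemma cj_eq_cocycle_of:
  assumes k: "2 \<le> k" "k \<le> card (UNIV :: 'f set)" and j: "j \<le> k - 2"
  shows "cj \<iota> k m j = cocycle_of k m (\<lambda>l. if l = j then 1 else 0)"
proof -
  let ?w = "\<lambda>l. if l = j then 1 else 0 :: 'c"
  have "?w \<in> homV k"
    using j by (simp add: homV_def)
  then have w: "cocycle_of k m ?w gamma0 = ?w"
    by (rule cocycle_of_gamma0)
  show ?thesis
    unfolding cj_def
  proof (intro the_equality conjI cocycle_of_harmonic[OF k] w)
    fix c assume "c \<in> H k m \<and> c gamma0 = ?w"
    then show "c = cocycle_of k m ?w"
      using w by (intro cocycle_eqI[of _ k m] cocycle_of_harmonic[OF k]) simp_all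
  qed
qed

lemma cj_harmonic:
  assumes "2 \<le> k" "k \<le> card (UNIV :: 'f set)" "j \<le> k - 2"
  shows "cj \<iota> k m j \<in> H k m"
  using cocycle_of_harmonic assms by (simp add: cj_eq_cocycle_of)

lemma cj_gamma0:
  assumes "2 \<le> k" "k \<le> card (UNIV :: 'f set)" "j \<le> k - 2"
  shows "cj \<iota> k m j gamma0 = (\<lambda>l. if l = j then 1 else 0)"
  using assms by (simp add: cj_eq_cocycle_of cocycle_of_gamma0 homV_def)

lemma cocycle_expansion:
  assumes k: "2 \<le> k" "k \<le> card (UNIV :: 'f set)" and c: "c \<in> H k m"
  shows "c = (\<lambda>E l. \<Sum>j\<le>k-2. c gamma0 j * cj \<iota> k m j E l)"
proof (rule cocycle_eqI[OF c])
  show "(\<lambda>E l. \<Sum>j\<le>k-2. c gamma0 j * cj \<iota> k m j E l) \<in> H k m"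
    using cj_harmonic[OF k] by (intro cocycle_sum) simp
  have "(\<Sum>j\<le>k-2. c gamma0 j * cj \<iota> k m j gamma0 l) = (\<Sum>j\<le>k-2. if l = j then c gamma0 j else 0)" for l
    by (intro sum.cong) (auto simp: cj_gamma0[OF k])
  then show "c gamma0 = (\<lambda>l. \<Sum>j\<le>k-2. c gamma0 j * cj \<iota> k m j gamma0 l)"
    using cocycle_homV[OF c, of gamma0] by (auto simp: fun_eq_iff homV_def)
qed

lemma cj_independent:
  assumes k: "2 \<le> k" "k \<le> card (UNIV :: 'f set)"
    and z: "\<And>E l. (\<Sum>j\<le>k-2. c j * cj \<iota> k m j E l) = 0" and i: "i \<le> k - 2"
  shows "c i = 0"
proof -
  have "0 = (\<Sum>j\<le>k-2. c j * cj \<iota> k m j gamma0 i)"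
    by (simp add: z)
  also have "\<dots> = (\<Sum>j\<le>k-2. if i = j then c j else 0)"
    by (intro sum.cong) (auto simp: cj_gamma0[OF k])
  finally show ?thesis
    using i by simp
qed

lemma hecke_cj:
  assumes k: "2 \<le> k" "k \<le> card (UNIV :: 'f set)" and P: "degree P = 1" "poly P 0 = 1"
    and j: "j \<le> k - 2"
  shows "hecke \<iota> k m P (cj \<iota> k m j) = (\<lambda>E l. \<iota> (Kinf_of_poly (lambdaj k j P)) * cj \<iota> k m j E l)"
proof (rule cocycle_eqI)
  show T: "hecke \<iota> k m P (cj \<iota> k m j) \<in> H k m"
    by (rule hecke_harmonic[OF P cj_harmonic[OF k j]])
  show "(\<lambda>E l. \<iota> (Kinf_of_poly (lambdaj k j P)) * cj \<iota> k m j E l) \<in> H k m"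
    using cocycle_sum[of "{()}" "\<lambda>_. cj \<iota> k m j" k m "\<lambda>_. \<iota> (Kinf_of_poly (lambdaj k j P))"]
      cj_harmonic[OF k j] by simp
  show "hecke \<iota> k m P (cj \<iota> k m j) gamma0 = (\<lambda>l. \<iota> (Kinf_of_poly (lambdaj k j P)) * cj \<iota> k m j gamma0 l)"
  proof (rule ext)
    fix l
    show "hecke \<iota> k m P (cj \<iota> k m j) gamma0 l = \<iota> (Kinf_of_poly (lambdaj k j P)) * cj \<iota> k m j gamma0 l"
    proof (cases "l \<le> k - 2")
      case True
      have "(\<lambda>l. if l = j then 1 else 0) \<in> homV k"
        using j by (simp add: homV_def)
      \<comment> \<open>Coordinate \<open>l\<close> is scaled by \<open>lambdaj k l P\<close>; since
        \<open>cj\<close> has only the coordinate \<open>j\<close> at \<open>gamma0\<close>, only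
        \<open>lambdaj k j P\<close> survives.\<close>
      then have "hecke \<iota> k m P (cj \<iota> k m j) gamma0 l
          = \<iota> (Kinf_of_poly (lambdaj k l P)) * (if l = j then 1 else 0)"
        unfolding cj_eq_cocycle_of[OF k j] using hecke_cocycle_of_gamma0[OF k P _ True] by blast
      then show ?thesis
        by (simp add: cj_gamma0[OF k j])
    next
      case False
      then show ?thesis
        using cocycle_homV[OF T, of gamma0] j by (auto simp: homV_def cj_gamma0[OF k j])
    qed
  qed
qed

end

theorem theorem7p2:
  fixes \<iota> :: "'f::{field,finite} fls \<Rightarrow> 'c::field"
    and k :: nat and m :: int
  assumes hom_one: "\<iota> 1 = 1"
    and hom_add: "\<And>x y. \<iota> (x + y) = \<iota> x + \<iota> y"
    and hom_mult: "\<And>x y. \<iota> (x * y) = \<iota> x * \<iota> y"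
    and k: "2 \<le> k" "k \<le> card (UNIV :: 'f set)"
  shows
    \<comment> \<open>the c_j exist, are harmonic cocycles, and form a basis of H_{k,m}(Gamma_1(T))\<close>
    "(\<forall>j \<le> k - 2. cj \<iota> k m j \<in> harmonic_cocycles \<iota> k m Gamma1T
                  \<and> cj \<iota> k m j gamma0 = (\<lambda>l. if l = j then 1 else 0))
     \<and> (\<forall>c \<in> harmonic_cocycles \<iota> k m Gamma1T.
          c = (\<lambda>E l. \<Sum>j\<le>k-2. c gamma0 j * cj \<iota> k m j E l))
     \<and> (\<forall>c. (\<forall>E l. (\<Sum>j\<le>k-2. c j * cj \<iota> k m j E l) = 0) \<longrightarrow> (\<forall>j\<le>k-2. c j = 0))
    \<comment> \<open>each c_j is an eigenvector of every T_P with deg P = 1, P(0) = 1, eigenvalue lambda_j(P)\<close>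
     \<and> (\<forall>P :: 'f poly. degree P = 1 \<and> poly P 0 = 1 \<longrightarrow>
          (\<forall>j \<le> k - 2. hecke \<iota> k m P (cj \<iota> k m j)
               = (\<lambda>E l. \<iota> (Kinf_of_poly (lambdaj k j P)) * cj \<iota> k m j E l)))"
proof -
  interpret laurent_embedding \<iota>
    by unfold_locales (fact hom_one hom_add hom_mult)+
  show ?thesis
    using cj_harmonic[OF k] cj_gamma0[OF k] cocycle_expansion[OF k] cj_independent[OF k] hecke_cj[OF k]
    by blast
qed

end
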